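(* Let $G$ be a groupoid. Let $B=\mathbb CG$ be the groupoid algebra and define $\Delta$ on $B$ by $\Delta(\lambda_p)=\lambda_p\otimes\lambda_p$, where $p\mapsto\lambda_p$ is the imbedding of $G$ in $\mathbb CG$. Then $(B,\Delta)$ is a weak multiplier Hopf algebra. Its antipode $S$ is given by $S(\lambda_p)=\lambda_{p^{-1}}$ for all $p\in G$.
   Context: A groupoid $G$ is a set with a partially defined associative product and inverses; each $p\in G$ has a source $s(p)$ and a target $t(p)$, which are units (regarded as elements of $G$), and $pq$ is defined iff $s(p)=t(q)$. The groupoid algebra $\mathbb CG$ has linear basis $(\lambda_p)_{p\in G}$ and product $\lambda_p\lambda_q=\lambda_{pq}$ if $pq$ is defined and $\lambda_p\lambda_q=0$ otherwise. General conventions. Algebras are associative over $\mathbb C$, not necessarily unital, with non-degenerate product ($ab=0$ for all $b$ implies $a=0$, and $ba=0$ for all $b$ implies $a=0$). $M(A)$ is the multiplier algebra; $L(A)$ is the algebra of left multipliers (linear $\lambda:A\to A$ with $\lambda(ab)=\lambda(a)b$), and one writes $\lambda a$ for $\lambda(a)$. $\iota$ is the identity map. Expressions such as $XY$ for subspaces denote linear spans of products. A coproduct on $A$ is a homomorphism $\Delta:A\to M(A\otimes A)$ with $\Delta(a)(1\otimes b)\in A\otimes A$ and $(a\otimes 1)\Delta(b)\in A\otimes A$ for all $a,b$, and $(a\otimes1\otimes1)(\Delta\otimes\iota)(\Delta(b)(1\otimes c))=(\iota\otimes\Delta)((a\otimes1)\Delta(b))(1\otimes1\otimes c)$ for all $a,b,c\in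 A$. It is full if the smallest subspaces $V,W\subseteq A$ with $\Delta(A)(1\otimes A)\subseteq V\otimes A$ and $(A\otimes1)\Delta(A)\subseteq A\otimes W$ are both equal to $A$. A counit is a linear map $\varepsilon:A\to\mathbb C$ with $(\varepsilon\otimes\iota)(\Delta(a)(1\otimes b))=ab$ and $(\iota\otimes\varepsilon)((a\otimes1)\Delta(b))=ab$ for all $a,b$ (unique when $\Delta$ is full). Put $T_1(a\otimes b)=\Delta(a)(1\otimes b)$ and $T_2(a\otimes b)=(a\otimes1)\Delta(b)$, linear maps $A\otimes A\to A\otimes A$. Weak multiplier Hopf algebra: a pair $(A,\Delta)$ where $A$ is non-degenerate and idempotent ($A^2=A$), $\Delta$ is a full coproduct with a counit $\varepsilon$, and the following hold. (1) There is an idempotent $E\in M(A\otimes A)$ with $\mathrm{Ran}(T_1)=E(A\otimes A)$ and $\mathrm{Ran}(T_2)=(A\otimes A)E$. (Then $E$ is unique, and $\Delta\otimes\iota$ and $\iota\otimes\Delta$ extend uniquely to homomorphisms $M(A\otimes A)\to M(A\otimes A\otimes A)$ sending $1$ to $E\otimes1$ and to $1\otimes E$, respectively.) (2) $(\iota\otimes\Delta)(E)=(\Delta\otimes\iota)(E)=(1\otimes E)(E\otimes1)=(E\otimes1)(1\otimes E)$. (3) There are a right multiplier $F_1$ of $A\otimes A^{\mathrm{op}}$ and a left multiplier $F_2$ of $A^{\mathrm{op}}\otimes A$, i.e. linear maps $A\otimes A\to A\otimes A$, $a\otimes b\mapsto (a\otimes1)F_i(1\otimes b)$, satisfying $(a'a\otimes1)F_i(1\otimes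 bb')=(a'\otimes1)\big((a\otimes1)F_i(1\otimes b)\big)(1\otimes b')$, such that $E_{13}(F_1\otimes1)=E_{13}(1\otimes E)$ and $(1\otimes F_2)E_{13}=(E\otimes1)E_{13}$. Explicitly, for all $a,b,c,d\in A$: if $(a\otimes c)E=\sum_i p_i\otimes q_i$, then $\sum_i (p_i\otimes1)F_1(1\otimes b)\otimes q_id=\sum_i p_i\otimes(1\otimes q_i)E(b\otimes d)$; and if $E(a\otimes c)=\sum_i p_i\otimes q_i$, then $\sum_i dp_i\otimes(b\otimes1)F_2(1\otimes q_i)=\sum_i (d\otimes b)E(p_i\otimes1)\otimes q_i$. (4) $\mathrm{Ker}(T_1)=(A\otimes1)(1-F_1)(1\otimes A)$ and $\mathrm{Ker}(T_2)=(A\otimes1)(1-F_2)(1\otimes A)$. The elements $E,F_1,F_2$ are uniquely determined by $\Delta$. Antipode: let $R_1$ be the unique linear map on $A\otimes A$ with $T_1R_1T_1=T_1$, $R_1T_1R_1=R_1$, $T_1R_1(a\otimes b)=E(a\otimes b)$ and $R_1T_1(a\otimes b)=(a\otimes1)F_1(1\otimes b)$. The antipode $S$ is determined by $S(a)b=(\varepsilon\otimes\iota)R_1(a\otimes b)$ for $a,b\in A$ (a priori $S(a)\in L(A)$). *)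

theory Defs
  imports Complex_Main "HOL-Library.Poly_Mapping"
begin

section \<open>Complex vector spaces and algebras\<close>

class complex_vector = ab_group_add +
  fixes scaleC :: "complex \<Rightarrow> 'a \<Rightarrow> 'a" (infixr "*\<^sub>C" 75)
  assumes scaleC_add_right: "c *\<^sub>C (x + y) = c *\<^sub>C x + c *\<^sub>C y"
    and scaleC_add_left: "(c + d) *\<^sub>C x = c *\<^sub>C x + d *\<^sub>C x"
    and scaleC_scaleC: "c *\<^sub>C (d *\<^sub>C x) = (c * d) *\<^sub>C x"
    and scaleC_one [simp]: "1 *\<^sub>C x = x"

text \<open>Algebras are associative over the complex numbers and need not have a unit.\<close>

class complex_algebra = complex_vector + ring +
  assumes scaleC_times_left: "(c *\<^sub>C x) * y = c *\<^sub>C (x * y)"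
    and scaleC_times_right: "x * (c *\<^sub>C y) = c *\<^sub>C (x * y)"

interpretation complex_vector: vector_space "scaleC :: complex \<Rightarrow> 'a \<Rightarrow> 'a::complex_vector"
  by unfold_locales (simp_all add: scaleC_add_right scaleC_add_left scaleC_scaleC)

abbreviation clinear :: "('a::complex_vector \<Rightarrow> 'b::complex_vector) \<Rightarrow> bool"
  where "clinear \<equiv> Vector_Spaces.linear scaleC scaleC"

abbreviation cspan :: "'a::complex_vector set \<Rightarrow> 'a set"
  where "cspan \<equiv> complex_vector.span"

abbreviation csubspace :: "'a::complex_vector set \<Rightarrow> bool"
  where "csubspace \<equiv> complex_vector.subspace"

definition cbilinear :: "('a::complex_vector \<Rightarrow> 'b::complex_vector \<Rightarrow> 'c::complex_vector) \<Rightarrow> bool"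
  where "cbilinear \<beta> \<longleftrightarrow> (\<forall>a. clinear (\<beta> a)) \<and> (\<forall>b. clinear (\<lambda>a. \<beta> a b))"

lemma clinearI:
  assumes "\<And>x y. f (x + y) = f x + f y" and "\<And>c x. f (c *\<^sub>C x) = c *\<^sub>C f x"
  shows "clinear f"
  by unfold_locales (simp_all add: assms)

lemma clinear_add: "clinear f \<Longrightarrow> f (x + y) = f x + f y"
  by (rule module_hom.add[OF module_hom_iff_linear[THEN iffD2]])

lemma clinear_scale: "clinear f \<Longrightarrow> f (c *\<^sub>C x) = c *\<^sub>C f x"
  by (rule module_hom.scale[OF module_hom_iff_linear[THEN iffD2]])

lemma clinear_zero: "clinear f \<Longrightarrow> f 0 = 0"
  by (rule module_hom.zero[OF module_hom_iff_linear[THEN iffD2]])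

lemma clinear_neg: "clinear f \<Longrightarrow> f (- x) = - f x"
  by (rule module_hom.neg[OF module_hom_iff_linear[THEN iffD2]])

lemma clinear_diff: "clinear f \<Longrightarrow> f (x - y) = f x - f y"
  by (rule module_hom.diff[OF module_hom_iff_linear[THEN iffD2]])

lemma clinear_sum: "clinear f \<Longrightarrow> f (sum g S) = (\<Sum>a\<in>S. f (g a))"
  by (rule module_hom.sum[OF module_hom_iff_linear[THEN iffD2]])

lemma clinear_id: "clinear (\<lambda>x. x)"
  by (rule clinearI) simp_all

lemma clinear_compose: "clinear f \<Longrightarrow> clinear g \<Longrightarrow> clinear (\<lambda>x. g (f x))"
  by (rule clinearI) (simp_all add: clinear_add clinear_scale)

lemma clinear_zero_fun: "clinear (\<lambda>x. 0)"
  by (rule clinearI) simp_all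

lemma clinear_plus_fun: "clinear f \<Longrightarrow> clinear g \<Longrightarrow> clinear (\<lambda>x. f x + g x)"
  by (rule clinearI) (simp_all add: clinear_add clinear_scale scaleC_add_right algebra_simps)

lemma clinear_scale_fun: "clinear f \<Longrightarrow> clinear (\<lambda>x. c *\<^sub>C f x)"
  by (rule clinearI) (simp_all add: clinear_add clinear_scale scaleC_add_right scaleC_scaleC mult.commute)

lemma clinear_neg_fun: "clinear f \<Longrightarrow> clinear (\<lambda>x. - f x)"
  by (rule clinearI) (simp_all add: clinear_add clinear_scale)

lemma clinear_diff_fun: "clinear f \<Longrightarrow> clinear g \<Longrightarrow> clinear (\<lambda>x. f x - g x)"
  by (rule clinearI) (simp_all add: clinear_add clinear_scale complex_vector.scale_right_diff_distrib)

lemma clinear_times_left: "clinear (\<lambda>y. x * y :: 'a::complex_algebra)"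
  by (rule clinearI) (simp_all add: distrib_left scaleC_times_right)

lemma clinear_times_right: "clinear (\<lambda>y. y * x :: 'a::complex_algebra)"
  by (rule clinearI) (simp_all add: distrib_right scaleC_times_left)

lemma cbilinearI:
  assumes "\<And>a. clinear (\<beta> a)" and "\<And>b. clinear (\<lambda>a. \<beta> a b)"
  shows "cbilinear \<beta>"
  using assms by (simp add: cbilinear_def)

lemma cbilinear1: "cbilinear \<beta> \<Longrightarrow> clinear (\<lambda>a. \<beta> a b)"
  by (simp add: cbilinear_def)

lemma cbilinear2: "cbilinear \<beta> \<Longrightarrow> clinear (\<beta> a)"
  by (simp add: cbilinear_def)

instantiation complex :: complex_algebra
begin
definition scaleC_complex :: "complex \<Rightarrow> complex \<Rightarrow> complex" where "scaleC_complex = (*)"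
instance by standard (simp_all add: scaleC_complex_def algebra_simps)
end

section \<open>Free vector spaces\<close>

instantiation poly_mapping :: (type, complex_vector) complex_vector
begin

lift_definition scaleC_poly_mapping :: "complex \<Rightarrow> ('a \<Rightarrow>\<^sub>0 'b) \<Rightarrow> 'a \<Rightarrow>\<^sub>0 'b"
  is "\<lambda>c f k. c *\<^sub>C f k"
proof -
  fix c and f :: "'a \<Rightarrow> 'b"
  assume "finite {k. f k \<noteq> 0}"
  then show "finite {k. c *\<^sub>C f k \<noteq> 0}"
    by (rule rev_finite_subset) auto
qed

instance
  by standard (transfer, simp add: fun_eq_iff scaleC_add_right scaleC_add_left scaleC_scaleC)+

end

lemma lookup_scaleC [simp]:
  "Poly_Mapping.lookup (c *\<^sub>C x) k = c *\<^sub>C Poly_Mapping.lookup x k"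
  by transfer simp

text \<open>The linear extension of a map on the standard basis.\<close>

definition free_lift :: "('k \<Rightarrow> 'v::complex_vector) \<Rightarrow> ('k \<Rightarrow>\<^sub>0 complex) \<Rightarrow> 'v"
  where "free_lift \<phi> x = (\<Sum>k\<in>Poly_Mapping.keys x. Poly_Mapping.lookup x k *\<^sub>C \<phi> k)"

lemma free_lift_superset:
  assumes "finite K" "Poly_Mapping.keys x \<subseteq> K"
  shows "free_lift \<phi> x = (\<Sum>k\<in>K. Poly_Mapping.lookup x k *\<^sub>C \<phi> k)"
  unfolding free_lift_def using assms
  by (intro sum.mono_neutral_left) (auto simp: in_keys_iff)

lemma clinear_free_lift: "clinear (free_lift \<phi>)"
proof (rule clinearI)
  fix x y :: "'a \<Rightarrow>\<^sub>0 complex" and c :: complex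
  let ?K = "Poly_Mapping.keys x \<union> Poly_Mapping.keys y"
  have "free_lift \<phi> (x + y) = (\<Sum>k\<in>?K. Poly_Mapping.lookup (x + y) k *\<^sub>C \<phi> k)"
    by (rule free_lift_superset) (simp_all add: keys_add)
  also have "\<dots> = free_lift \<phi> x + free_lift \<phi> y"
    by (simp add: lookup_add scaleC_add_left sum.distrib free_lift_superset[of ?K])
  finally show "free_lift \<phi> (x + y) = free_lift \<phi> x + free_lift \<phi> y" .
  have "free_lift \<phi> (c *\<^sub>C x) = (\<Sum>k\<in>Poly_Mapping.keys x. Poly_Mapping.lookup (c *\<^sub>C x) k *\<^sub>C \<phi> k)"
    by (rule free_lift_superset) (auto simp: in_keys_iff scaleC_complex_def)
  then show "free_lift \<phi> (c *\<^sub>C x) = c *\<^sub>C free_lift \<phi> x"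
    by (simp add: free_lift_def complex_vector.scale_sum_right scaleC_complex_def)
qed

lemma free_lift_single [simp]: "free_lift \<phi> (Poly_Mapping.single k c) = c *\<^sub>C \<phi> k"
  by (cases "c = 0") (simp_all add: free_lift_def)

lemma free_lift_eq:
  fixes f :: "('k \<Rightarrow>\<^sub>0 complex) \<Rightarrow> 'v::complex_vector"
  assumes "clinear f"
  shows "f x = free_lift (\<lambda>k. f (Poly_Mapping.single k 1)) x"
proof -
  have *: "x = (\<Sum>k\<in>Poly_Mapping.keys x. Poly_Mapping.lookup x k *\<^sub>C Poly_Mapping.single k 1)"
  proof (rule poly_mapping_eqI)
    fix j
    show "Poly_Mapping.lookup x j = Poly_Mapping.lookup (\<Sum>k\<in>Poly_Mapping.keys x. Poly_Mapping.lookup x k *\<^sub>C Poly_Mapping.single k 1) j"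
      by (cases "j \<in> Poly_Mapping.keys x")
        (auto simp: lookup_sum lookup_single scaleC_complex_def when_def in_keys_iff if_distrib
          sum.delta cong: if_cong)
  qed
  have "f x = f (\<Sum>k\<in>Poly_Mapping.keys x. Poly_Mapping.lookup x k *\<^sub>C Poly_Mapping.single k 1)"
    using * by simp
  then show ?thesis
    by (simp add: clinear_sum[OF assms] clinear_scale[OF assms] free_lift_def)
qed

section \<open>Tensor products\<close>

text \<open>
  The algebraic tensor product is the free vector space on pairs modulo the span of the
  bilinearity relations.
\<close>

inductive_set tensor_relations :: "('a::complex_vector \<times> 'b::complex_vector \<Rightarrow>\<^sub>0 complex) set"
  where
    add_left: "Poly_Mapping.single (a + a', b) 1 - Poly_Mapping.single (a, b) 1 - Poly_Mapping.single (a', b) 1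
      \<in> tensor_relations"
  | add_right: "Poly_Mapping.single (a, b + b') 1 - Poly_Mapping.single (a, b) 1 - Poly_Mapping.single (a, b') 1
      \<in> tensor_relations"
  | scale_left: "Poly_Mapping.single (c *\<^sub>C a, b) 1 - c *\<^sub>C Poly_Mapping.single (a, b) 1 \<in> tensor_relations"
  | scale_right: "Poly_Mapping.single (a, c *\<^sub>C b) 1 - c *\<^sub>C Poly_Mapping.single (a, b) 1 \<in> tensor_relations"

definition tensor_rel ::
    "('a::complex_vector \<times> 'b::complex_vector \<Rightarrow>\<^sub>0 complex) \<Rightarrow> ('a \<times> 'b \<Rightarrow>\<^sub>0 complex) \<Rightarrow> bool"
  where "tensor_rel x y \<longleftrightarrow> x - y \<in> cspan tensor_relations"

lemma equivp_tensor_rel: "equivp (tensor_rel ::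
    ('a::complex_vector \<times> 'b::complex_vector \<Rightarrow>\<^sub>0 complex) \<Rightarrow> _)" (is "equivp ?R")
proof (rule equivpI)
  show "reflp ?R"
    by (rule reflpI) (simp add: tensor_rel_def complex_vector.span_zero)
  show "symp ?R"
  proof (rule sympI)
    fix x y :: "'a \<times> 'b \<Rightarrow>\<^sub>0 complex"
    assume "tensor_rel x y"
    then have "- (x - y) \<in> cspan tensor_relations"
      unfolding tensor_rel_def by (rule complex_vector.span_neg)
    then show "tensor_rel y x" by (simp add: tensor_rel_def)
  qed
  show "transp ?R"
  proof (rule transpI)
    fix x y z :: "'a \<times> 'b \<Rightarrow>\<^sub>0 complex"
    assume "tensor_rel x y" "tensor_rel y z"
    then have "(x - y) + (y - z) \<in> cspan tensor_relations"
      unfolding tensor_rel_def by (rule complex_vector.span_add)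
    then show "tensor_rel x z" by (simp add: tensor_rel_def)
  qed
qed

quotient_type (overloaded) ('a, 'b) tensor =
    "'a::complex_vector \<times> 'b::complex_vector \<Rightarrow>\<^sub>0 complex" / tensor_rel
  by (rule equivp_tensor_rel)

instantiation tensor :: (complex_vector, complex_vector) complex_vector
begin

lift_definition zero_tensor :: "('a, 'b) tensor" is 0 .

lift_definition plus_tensor :: "('a, 'b) tensor \<Rightarrow> ('a, 'b) tensor \<Rightarrow> ('a, 'b) tensor" is "(+)"
proof -
  fix x x' y y' :: "'a \<times> 'b \<Rightarrow>\<^sub>0 complex"
  assume "tensor_rel x x'" "tensor_rel y y'"
  then have "(x - x') + (y - y') \<in> cspan tensor_relations"
    unfolding tensor_rel_def by (rule complex_vector.span_add)
  then show "tensor_rel (x + y) (x' + y')" by (simp add: tensor_rel_def algebra_simps)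
qed

lift_definition minus_tensor :: "('a, 'b) tensor \<Rightarrow> ('a, 'b) tensor \<Rightarrow> ('a, 'b) tensor" is "(-)"
proof -
  fix x x' y y' :: "'a \<times> 'b \<Rightarrow>\<^sub>0 complex"
  assume "tensor_rel x x'" "tensor_rel y y'"
  then have "(x - x') - (y - y') \<in> cspan tensor_relations"
    unfolding tensor_rel_def by (rule complex_vector.span_diff)
  then show "tensor_rel (x - y) (x' - y')" by (simp add: tensor_rel_def algebra_simps)
qed

lift_definition uminus_tensor :: "('a, 'b) tensor \<Rightarrow> ('a, 'b) tensor" is uminus
proof -
  fix x x' :: "'a \<times> 'b \<Rightarrow>\<^sub>0 complex"
  assume "tensor_rel x x'"
  then have "- (x - x') \<in> cspan tensor_relations"
    unfolding tensor_rel_def by (rule complex_vector.span_neg)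
  then show "tensor_rel (- x) (- x')" by (simp add: tensor_rel_def)
qed

lift_definition scaleC_tensor :: "complex \<Rightarrow> ('a, 'b) tensor \<Rightarrow> ('a, 'b) tensor" is scaleC
proof -
  fix c and x x' :: "'a \<times> 'b \<Rightarrow>\<^sub>0 complex"
  assume "tensor_rel x x'"
  then have "c *\<^sub>C (x - x') \<in> cspan tensor_relations"
    unfolding tensor_rel_def by (rule complex_vector.span_scale)
  then show "tensor_rel (c *\<^sub>C x) (c *\<^sub>C x')"
    by (simp add: tensor_rel_def complex_vector.scale_right_diff_distrib)
qed

instance
proof
  fix x y z :: "('a, 'b) tensor" and c d :: complex
  have refl: "tensor_rel u u" for u :: "'a \<times> 'b \<Rightarrow>\<^sub>0 complex"
    by (simp add: tensor_rel_def complex_vector.span_zero)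
  show "x + y + z = x + (y + z)" by transfer (simp add: add.assoc refl)
  show "x + y = y + x" by transfer (simp add: add.commute refl)
  show "0 + x = x" by transfer (simp add: refl)
  show "- x + x = 0" by transfer (simp add: refl)
  show "x - y = x + - y" by transfer (simp add: refl)
  show "c *\<^sub>C (x + y) = c *\<^sub>C x + c *\<^sub>C y" by transfer (simp add: scaleC_add_right refl)
  show "(c + d) *\<^sub>C x = c *\<^sub>C x + d *\<^sub>C x" by transfer (simp add: scaleC_add_left refl)
  show "c *\<^sub>C (d *\<^sub>C x) = (c * d) *\<^sub>C x" by transfer (simp add: scaleC_scaleC refl)
  show "1 *\<^sub>C x = x" by transfer (simp add: refl)
qed

end

lift_definition tensor :: "'a::complex_vector \<Rightarrow> 'b::complex_vector \<Rightarrow> ('a, 'b) tensor" (infixr "\<otimes>" 72)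
  is "\<lambda>a b. Poly_Mapping.single (a, b) 1" .

lemma cbilinear_tensor: "cbilinear (\<otimes>)"
proof (intro cbilinearI clinearI)
  fix a a' :: 'a and b b' :: 'b and c :: complex
  have base: "u - v - w \<in> tensor_relations \<Longrightarrow> tensor_rel u (v + w)"
      "u - v \<in> tensor_relations \<Longrightarrow> tensor_rel u v"
    for u v w :: "'a \<times> 'b \<Rightarrow>\<^sub>0 complex"
    by (auto simp: tensor_rel_def diff_diff_eq intro: complex_vector.span_base)
  show "a \<otimes> (b + b') = a \<otimes> b + a \<otimes> b'"
    by transfer (rule base, rule tensor_relations.intros)
  show "(a + a') \<otimes> b = a \<otimes> b + a' \<otimes> b"
    by transfer (rule base, rule tensor_relations.intros)
  show "a \<otimes> (c *\<^sub>C b) = c *\<^sub>C (a \<otimes> b)"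
    by transfer (rule base, rule tensor_relations.intros)
  show "(c *\<^sub>C a) \<otimes> b = c *\<^sub>C (a \<otimes> b)"
    by transfer (rule base, rule tensor_relations.intros)
qed

lemmas tensor_add_left = clinear_add[OF cbilinear1[OF cbilinear_tensor]]
  and tensor_add_right = clinear_add[OF cbilinear2[OF cbilinear_tensor]]
  and tensor_scale_left = clinear_scale[OF cbilinear1[OF cbilinear_tensor]]
  and tensor_scale_right = clinear_scale[OF cbilinear2[OF cbilinear_tensor]]

text \<open>
  The linear map on the tensor product induced by a bilinear map; it does not depend on the
  chosen representative when \<open>\<beta>\<close> is bilinear, and is only used for such \<open>\<beta>\<close>.
\<close>

definition tensor_lift ::
    "('a::complex_vector \<Rightarrow> 'b::complex_vector \<Rightarrow> 'c::complex_vector) \<Rightarrow> ('a, 'b) tensor \<Rightarrow> 'c"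
  where "tensor_lift \<beta> t = free_lift (\<lambda>(a, b). \<beta> a b) (rep_tensor t)"

lemma tensor_lift_abs:
  assumes "cbilinear \<beta>"
  shows "tensor_lift \<beta> (abs_tensor x) = free_lift (\<lambda>(a, b). \<beta> a b) x"
proof -
  let ?f = "free_lift (\<lambda>(a, b). \<beta> a b)"
  note lin = clinear_free_lift[of "\<lambda>(a, b). \<beta> a b"]
  have "tensor_rel (rep_tensor (abs_tensor x)) x"
    by (rule Quotient3_rep_abs[OF Quotient3_tensor]) (simp add: tensor_rel_def complex_vector.span_zero)
  then have "rep_tensor (abs_tensor x) - x \<in> cspan tensor_relations"
    by (simp add: tensor_rel_def)
  then have "?f (rep_tensor (abs_tensor x) - x) = 0"
  proof (rule complex_vector.span_induct)
    show "csubspace {y. ?f y = 0}"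
      by (simp add: complex_vector.subspace_def clinear_zero[OF lin] clinear_add[OF lin] clinear_scale[OF lin])
    fix y :: "'a \<times> 'b \<Rightarrow>\<^sub>0 complex"
    assume "y \<in> tensor_relations"
    then show "?f y = 0"
      by cases (auto simp: clinear_diff[OF lin] clinear_scale[OF lin]
          clinear_add[OF cbilinear1[OF assms]] clinear_add[OF cbilinear2[OF assms]]
          clinear_scale[OF cbilinear1[OF assms]] clinear_scale[OF cbilinear2[OF assms]])
  qed
  then show ?thesis
    by (simp add: tensor_lift_def clinear_diff[OF lin])
qed

lemma clinear_tensor_lift:
  assumes "cbilinear \<beta>"
  shows "clinear (tensor_lift \<beta>)"
proof (rule clinearI)
  note lin = clinear_free_lift[of "\<lambda>(a, b). \<beta> a b"]
  fix s t :: "('a, 'b) tensor" and c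
  obtain x y where xy: "s = abs_tensor x" "t = abs_tensor y"
    by (metis Quotient3_abs_rep[OF Quotient3_tensor])
  show "tensor_lift \<beta> (s + t) = tensor_lift \<beta> s + tensor_lift \<beta> t"
    by (simp add: xy plus_tensor.abs_eq tensor_lift_abs[OF assms] clinear_add[OF lin])
  show "tensor_lift \<beta> (c *\<^sub>C s) = c *\<^sub>C tensor_lift \<beta> s"
    by (simp add: xy scaleC_tensor.abs_eq tensor_lift_abs[OF assms] clinear_scale[OF lin])
qed

lemma tensor_lift_tensor:
  assumes "cbilinear \<beta>"
  shows "tensor_lift \<beta> (a \<otimes> b) = \<beta> a b"
  by (simp add: tensor.abs_eq tensor_lift_abs[OF assms])

lemma tensor_ext:
  fixes f g :: "('a::complex_vector, 'b::complex_vector) tensor \<Rightarrow> 'c::complex_vector"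
  assumes "clinear f" "clinear g" "\<And>a b. f (a \<otimes> b) = g (a \<otimes> b)"
  shows "f t = g t"
proof -
  obtain x where x: "t = abs_tensor x"
    by (metis Quotient3_abs_rep[OF Quotient3_tensor])
  have abs: "clinear (abs_tensor :: _ \<Rightarrow> ('a, 'b) tensor)"
    by (rule clinearI) (simp_all add: plus_tensor.abs_eq scaleC_tensor.abs_eq)
  have *: "abs_tensor (Poly_Mapping.single k 1) = fst k \<otimes> snd k" for k :: "'a \<times> 'b"
    by (simp add: tensor.abs_eq)
  have "f (abs_tensor x) = g (abs_tensor x)"
    using free_lift_eq[OF clinear_compose[OF abs assms(1)], of x]
      free_lift_eq[OF clinear_compose[OF abs assms(2)], of x]
    by (simp add: * assms(3))
  then show ?thesis by (simp add: x)
qed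

lemma clinear_tensor_lift_param:
  assumes "\<And>z. cbilinear (\<beta> z)" "\<And>a b. clinear (\<lambda>z. \<beta> z a b)"
  shows "clinear (\<lambda>z. tensor_lift (\<beta> z) t)"
proof (rule clinearI)
  fix x y c
  note lift = clinear_tensor_lift[OF assms(1)] and pure = tensor_lift_tensor[OF assms(1)]
  show "tensor_lift (\<beta> (x + y)) t = tensor_lift (\<beta> x) t + tensor_lift (\<beta> y) t"
    by (rule tensor_ext[OF lift clinear_plus_fun[OF lift lift]]) (simp add: pure clinear_add[OF assms(2)])
  show "tensor_lift (\<beta> (c *\<^sub>C x)) t = c *\<^sub>C tensor_lift (\<beta> x) t"
    by (rule tensor_ext[OF lift clinear_scale_fun[OF lift]]) (simp add: pure clinear_scale[OF assms(2)])
qed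

instantiation tensor :: (complex_algebra, complex_algebra) complex_algebra
begin

definition times_tensor :: "('a, 'b) tensor \<Rightarrow> ('a, 'b) tensor \<Rightarrow> ('a, 'b) tensor"
  where "s * t = tensor_lift (\<lambda>a b. tensor_lift (\<lambda>c d. (a * c) \<otimes> (b * d)) t) s"

instance
proof -
  have 1: "cbilinear (\<lambda>c d. (a * c) \<otimes> (b * d))" for a :: 'a and b :: 'b
    by (intro cbilinearI clinear_compose[OF clinear_times_left]
        cbilinear1[OF cbilinear_tensor] cbilinear2[OF cbilinear_tensor])
  have l: "cbilinear (\<lambda>a b. (a * c) \<otimes> (b * d))" for c :: 'a and d :: 'b
    by (intro cbilinearI clinear_compose[OF clinear_times_right]
        cbilinear1[OF cbilinear_tensor] cbilinear2[OF cbilinear_tensor])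
  have 2: "cbilinear (\<lambda>a b. tensor_lift (\<lambda>c d. (a * c) \<otimes> (b * d)) t)" for t :: "('a, 'b) tensor"
    by (rule cbilinearI; rule clinear_tensor_lift_param)
      (rule 1 cbilinear1[OF l] cbilinear2[OF l])+
  have r: "clinear (\<lambda>s. s * t)" for t :: "('a, 'b) tensor"
    unfolding times_tensor_def by (rule clinear_tensor_lift[OF 2])
  have pure1: "(a \<otimes> b) * t = tensor_lift (\<lambda>c d. (a * c) \<otimes> (b * d)) t" for a b and t :: "('a, 'b) tensor"
    unfolding times_tensor_def by (rule tensor_lift_tensor[OF 2])
  have pure: "(a \<otimes> b) * (c \<otimes> d) = (a * c) \<otimes> (b * d)" for a c :: 'a and b d :: 'b
    unfolding pure1 by (rule tensor_lift_tensor[OF 1])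
  have l1: "clinear (\<lambda>t. (a \<otimes> b) * t)" for a :: 'a and b :: 'b
    unfolding pure1 by (rule clinear_tensor_lift[OF 1])
  have l: "clinear (\<lambda>t. s * t)" for s :: "('a, 'b) tensor"
  proof (rule clinearI)
    fix x y c
    show "s * (x + y) = s * x + s * y"
      by (rule tensor_ext[OF r clinear_plus_fun[OF r r]]) (simp add: clinear_add[OF l1])
    show "s * (c *\<^sub>C x) = c *\<^sub>C (s * x)"
      by (rule tensor_ext[OF r clinear_scale_fun[OF r]]) (simp add: clinear_scale[OF l1])
  qed
  show "OFCLASS(('a, 'b) tensor, complex_algebra_class)"
  proof
    fix s t u :: "('a, 'b) tensor" and c
    show "s * t * u = s * (t * u)"
    proof (rule tensor_ext[OF clinear_compose[OF r r] r])
      fix a b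
      show "(a \<otimes> b) * t * u = (a \<otimes> b) * (t * u)"
      proof (rule tensor_ext[OF clinear_compose[OF l r] clinear_compose[OF r l]])
        fix a' b'
        show "(a \<otimes> b) * (a' \<otimes> b') * u = (a \<otimes> b) * ((a' \<otimes> b') * u)"
          by (rule tensor_ext[OF l clinear_compose[OF l l]]) (simp add: pure mult.assoc)
      qed
    qed
    show "(s + t) * u = s * u + t * u" by (rule clinear_add[OF r])
    show "s * (t + u) = s * t + s * u" by (rule clinear_add[OF l])
    show "(c *\<^sub>C s) * t = c *\<^sub>C (s * t)" by (rule clinear_scale[OF r])
    show "s * (c *\<^sub>C t) = c *\<^sub>C (s * t)" by (rule clinear_scale[OF l])
  qed
qed

end

lemma tensor_times_tensor [simp]: "(a \<otimes> b) * (c \<otimes> d) = (a * c) \<otimes> (b * d)"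
proof -
  have 1: "cbilinear (\<lambda>c d. (a * c) \<otimes> (b * d))" for a :: 'a and b :: 'b
    by (intro cbilinearI clinear_compose[OF clinear_times_left]
        cbilinear1[OF cbilinear_tensor] cbilinear2[OF cbilinear_tensor])
  have l: "cbilinear (\<lambda>a b. (a * c) \<otimes> (b * d))" for c :: 'a and d :: 'b
    by (intro cbilinearI clinear_compose[OF clinear_times_right]
        cbilinear1[OF cbilinear_tensor] cbilinear2[OF cbilinear_tensor])
  have 2: "cbilinear (\<lambda>a b. tensor_lift (\<lambda>c d. (a * c) \<otimes> (b * d)) t)" for t :: "('a, 'b) tensor"
    by (rule cbilinearI; rule clinear_tensor_lift_param)
      (rule 1 cbilinear1[OF l] cbilinear2[OF l])+
  show ?thesis
    unfolding times_tensor_def by (simp add: tensor_lift_tensor[OF 2] tensor_lift_tensor[OF 1] tensor_lift_tensor[OF l])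
qed

definition tensor_map ::
    "('a::complex_vector \<Rightarrow> 'c::complex_vector) \<Rightarrow> ('b::complex_vector \<Rightarrow> 'd::complex_vector) \<Rightarrow>
      ('a, 'b) tensor \<Rightarrow> ('c, 'd) tensor"
  where "tensor_map f g = tensor_lift (\<lambda>a b. f a \<otimes> g b)"

lemma cbilinear_tensor_map:
  assumes "clinear f" "clinear g"
  shows "cbilinear (\<lambda>a b. f a \<otimes> g b)"
  by (intro cbilinearI clinear_compose[OF assms(1)] clinear_compose[OF assms(2)]
      cbilinear1[OF cbilinear_tensor] cbilinear2[OF cbilinear_tensor])

lemma clinear_tensor_map: "clinear f \<Longrightarrow> clinear g \<Longrightarrow> clinear (tensor_map f g)"
  unfolding tensor_map_def by (intro clinear_tensor_lift cbilinear_tensor_map)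

lemma tensor_map_tensor: "clinear f \<Longrightarrow> clinear g \<Longrightarrow> tensor_map f g (a \<otimes> b) = f a \<otimes> g b"
  unfolding tensor_map_def by (intro tensor_lift_tensor cbilinear_tensor_map)

text \<open>The canonical identification of the two bracketings of a threefold tensor product.\<close>

definition tensor_assoc ::
    "(('a::complex_vector, 'b::complex_vector) tensor, 'c::complex_vector) tensor \<Rightarrow> ('a, ('b, 'c) tensor) tensor"
  where "tensor_assoc = tensor_lift (\<lambda>t c. tensor_lift (\<lambda>a b. a \<otimes> b \<otimes> c) t)"

definition tensor_assoc_inv ::
    "('a::complex_vector, ('b::complex_vector, 'c::complex_vector) tensor) tensor \<Rightarrow> (('a, 'b) tensor, 'c) tensor"
  where "tensor_assoc_inv = tensor_lift (\<lambda>a t. tensor_lift (\<lambda>b c. (a \<otimes> b) \<otimes> c) t)"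

lemma cbilinear_assoc_aux1: "cbilinear (\<lambda>a b. a \<otimes> b \<otimes> c)"
  by (intro cbilinearI cbilinear1[OF cbilinear_tensor]
      clinear_compose[OF cbilinear1[OF cbilinear_tensor] cbilinear2[OF cbilinear_tensor]])

lemma cbilinear_assoc_aux2: "cbilinear (\<lambda>t c. tensor_lift (\<lambda>a b. a \<otimes> b \<otimes> c) t)"
  by (intro cbilinearI clinear_tensor_lift_param clinear_tensor_lift cbilinear_assoc_aux1
      clinear_compose[OF cbilinear2[OF cbilinear_tensor] cbilinear2[OF cbilinear_tensor]])

lemma cbilinear_assoc_aux3: "cbilinear (\<lambda>b c. (a \<otimes> b) \<otimes> c)"
  by (intro cbilinearI cbilinear2[OF cbilinear_tensor]
      clinear_compose[OF cbilinear2[OF cbilinear_tensor] cbilinear1[OF cbilinear_tensor]])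

lemma cbilinear_assoc_aux4: "cbilinear (\<lambda>a t. tensor_lift (\<lambda>b c. (a \<otimes> b) \<otimes> c) t)"
  by (intro cbilinearI clinear_tensor_lift_param clinear_tensor_lift cbilinear_assoc_aux3
      clinear_compose[OF cbilinear1[OF cbilinear_tensor] cbilinear1[OF cbilinear_tensor]])

lemma clinear_tensor_assoc: "clinear tensor_assoc"
  unfolding tensor_assoc_def by (rule clinear_tensor_lift[OF cbilinear_assoc_aux2])

lemma clinear_tensor_assoc_inv: "clinear tensor_assoc_inv"
  unfolding tensor_assoc_inv_def by (rule clinear_tensor_lift[OF cbilinear_assoc_aux4])

lemma tensor_assoc_tensor [simp]: "tensor_assoc ((a \<otimes> b) \<otimes> c) = a \<otimes> b \<otimes> c"
  unfolding tensor_assoc_def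
  by (simp add: tensor_lift_tensor[OF cbilinear_assoc_aux2] tensor_lift_tensor[OF cbilinear_assoc_aux1])

lemma tensor_assoc_inv_tensor [simp]: "tensor_assoc_inv (a \<otimes> b \<otimes> c) = (a \<otimes> b) \<otimes> c"
  unfolding tensor_assoc_inv_def
  by (simp add: tensor_lift_tensor[OF cbilinear_assoc_aux4] tensor_lift_tensor[OF cbilinear_assoc_aux3])

lemma tensor_ext3:
  assumes "clinear f" "clinear g" "\<And>a b c. f ((a \<otimes> b) \<otimes> c) = g ((a \<otimes> b) \<otimes> c)"
  shows "f t = g t"
  by (rule tensor_ext[OF assms(1,2)],
      rule tensor_ext[OF clinear_compose[OF cbilinear1[OF cbilinear_tensor] assms(1)]
        clinear_compose[OF cbilinear1[OF cbilinear_tensor] assms(2)]]) (rule assms(3))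

lemma tensor_ext3':
  assumes "clinear f" "clinear g" "\<And>a b c. f (a \<otimes> b \<otimes> c) = g (a \<otimes> b \<otimes> c)"
  shows "f t = g t"
  by (rule tensor_ext[OF assms(1,2)],
      rule tensor_ext[OF clinear_compose[OF cbilinear2[OF cbilinear_tensor] assms(1)]
        clinear_compose[OF cbilinear2[OF cbilinear_tensor] assms(2)]]) (rule assms(3))

lemma tensor_assoc_inv_assoc [simp]: "tensor_assoc_inv (tensor_assoc t) = t"
  by (rule tensor_ext3[OF clinear_compose[OF clinear_tensor_assoc clinear_tensor_assoc_inv] clinear_id]) simp

lemma tensor_assoc_assoc_inv [simp]: "tensor_assoc (tensor_assoc_inv t) = t"
  by (rule tensor_ext3'[OF clinear_compose[OF clinear_tensor_assoc_inv clinear_tensor_assoc] clinear_id]) simp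

lemma tensor_assoc_times: "tensor_assoc (s * t) = tensor_assoc s * tensor_assoc t"
proof (rule tensor_ext3[OF clinear_compose[OF clinear_times_right clinear_tensor_assoc]
      clinear_compose[OF clinear_tensor_assoc clinear_times_right]])
  fix a b c
  show "tensor_assoc (((a \<otimes> b) \<otimes> c) * t) = tensor_assoc ((a \<otimes> b) \<otimes> c) * tensor_assoc t"
    by (rule tensor_ext3[OF clinear_compose[OF clinear_times_left clinear_tensor_assoc]
          clinear_compose[OF clinear_tensor_assoc clinear_times_left]]) simp
qed

lemma tensor_assoc_inv_times: "tensor_assoc_inv (s * t) = tensor_assoc_inv s * tensor_assoc_inv t"
  by (metis tensor_assoc_assoc_inv tensor_assoc_inv_assoc tensor_assoc_times)

section \<open>Multipliers\<close>

text \<open>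
  A multiplier \<open>m\<close> is given by the maps \<open>x \<mapsto> m x\<close> and \<open>x \<mapsto> x m\<close>. For an algebra with
  non-degenerate product this is the usual multiplier algebra, and \<open>mult_of\<close> below is injective.
\<close>

typedef (overloaded) 'a multiplier = "{(L, R). clinear L \<and> clinear R \<and>
    (\<forall>x y. L (x * y) = L x * y) \<and> (\<forall>x y. R (x * y) = x * R y) \<and>
    (\<forall>x y. x * L y = R x * (y :: 'a::complex_algebra))}"
  by (rule exI[of _ "(\<lambda>x. x, \<lambda>x. x)"]) (simp add: clinear_id)

setup_lifting type_definition_multiplier

lift_definition mult_left :: "'a::complex_algebra multiplier \<Rightarrow> 'a \<Rightarrow> 'a" (infixr "\<rhd>" 71) is fst .

lift_definition mult_right :: "'a::complex_algebra \<Rightarrow> 'a multiplier \<Rightarrow> 'a" (infixl "\<lhd>" 71) is "\<lambda>x m. snd m x" .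

lemma clinear_mult_left: "clinear (\<lambda>x. m \<rhd> x)" by transfer auto
lemma clinear_mult_right: "clinear (\<lambda>x. x \<lhd> m)" by transfer auto
lemma mult_left_times: "m \<rhd> (x * y) = (m \<rhd> x) * y" by transfer auto
lemma mult_right_times: "(x * y) \<lhd> m = x * (y \<lhd> m)" by transfer auto
lemma mult_left_right: "x * (m \<rhd> y) = (x \<lhd> m) * y" by transfer auto

lemma multiplier_eqI: "(\<And>x. m \<rhd> x = n \<rhd> x) \<Longrightarrow> (\<And>x. x \<lhd> m = x \<lhd> n) \<Longrightarrow> m = n"
  by transfer (auto simp: fun_eq_iff)

instantiation multiplier :: (complex_algebra) "{complex_algebra, monoid_mult}"
begin

lift_definition zero_multiplier :: "'a multiplier" is "(\<lambda>x. 0, \<lambda>x. 0)"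
  by (simp add: clinear_zero_fun)

lift_definition one_multiplier :: "'a multiplier" is "(\<lambda>x. x, \<lambda>x. x)"
  by (simp add: clinear_id)

lift_definition plus_multiplier :: "'a multiplier \<Rightarrow> 'a multiplier \<Rightarrow> 'a multiplier"
  is "\<lambda>m n. (\<lambda>x. fst m x + fst n x, \<lambda>x. snd m x + snd n x)"
  by (auto simp: clinear_plus_fun distrib_left distrib_right)

lift_definition uminus_multiplier :: "'a multiplier \<Rightarrow> 'a multiplier"
  is "\<lambda>m. (\<lambda>x. - fst m x, \<lambda>x. - snd m x)"
  by (auto simp: clinear_neg_fun)

lift_definition minus_multiplier :: "'a multiplier \<Rightarrow> 'a multiplier \<Rightarrow> 'a multiplier"
  is "\<lambda>m n. (\<lambda>x. fst m x - fst n x, \<lambda>x. snd m x - snd n x)"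
  by (auto simp: clinear_diff_fun left_diff_distrib right_diff_distrib)

lift_definition scaleC_multiplier :: "complex \<Rightarrow> 'a multiplier \<Rightarrow> 'a multiplier"
  is "\<lambda>c m. (\<lambda>x. c *\<^sub>C fst m x, \<lambda>x. c *\<^sub>C snd m x)"
  by (auto simp: clinear_scale_fun scaleC_times_left scaleC_times_right)

lift_definition times_multiplier :: "'a multiplier \<Rightarrow> 'a multiplier \<Rightarrow> 'a multiplier"
  is "\<lambda>m n. (\<lambda>x. fst m (fst n x), \<lambda>x. snd n (snd m x))"
  by (auto simp: clinear_compose)

instance
proof
  fix m n k :: "'a multiplier" and c d
  show "m + n + k = m + (n + k)" by transfer (auto simp: algebra_simps)
  show "m + n = n + m" by transfer (auto simp: algebra_simps)
  show "0 + m = m" by transfer auto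
  show "- m + m = 0" by transfer auto
  show "m - n = m + - n" by transfer auto
  show "c *\<^sub>C (m + n) = c *\<^sub>C m + c *\<^sub>C n" by transfer (auto simp: scaleC_add_right)
  show "(c + d) *\<^sub>C m = c *\<^sub>C m + d *\<^sub>C m" by transfer (auto simp: scaleC_add_left)
  show "c *\<^sub>C (d *\<^sub>C m) = (c * d) *\<^sub>C m" by transfer (auto simp: scaleC_scaleC)
  show "1 *\<^sub>C m = m" by transfer auto
  show "m * n * k = m * (n * k)" by transfer auto
  show "(m + n) * k = m * k + n * k" by transfer (auto simp: clinear_add)
  show "m * (n + k) = m * n + m * k" by transfer (auto simp: clinear_add)
  show "(c *\<^sub>C m) * n = c *\<^sub>C (m * n)" by transfer (auto simp: clinear_scale)
  show "m * (c *\<^sub>C n) = c *\<^sub>C (m * n)" by transfer (auto simp: clinear_scale)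
  show "1 * m = m" by transfer auto
  show "m * 1 = m" by transfer auto
qed

end

lift_definition mult_of :: "'a::complex_algebra \<Rightarrow> 'a multiplier" is "\<lambda>a. (\<lambda>x. a * x, \<lambda>x. x * a)"
  by (simp add: clinear_times_left clinear_times_right mult.assoc)

text \<open>Meaningful for multipliers that come from the algebra, when the product is non-degenerate.\<close>

definition of_mult :: "'a::complex_algebra multiplier \<Rightarrow> 'a"
  where "of_mult m = (THE a. mult_of a = m)"

lift_definition mult_tensor ::
    "'a::complex_algebra multiplier \<Rightarrow> 'b::complex_algebra multiplier \<Rightarrow> ('a, 'b) tensor multiplier"
    (infixr "\<otimes>\<^sub>M" 72)
  is "\<lambda>m n. (tensor_map (fst m) (fst n), tensor_map (snd m) (snd n))"
proof (clarify, intro conjI allI)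
  fix L R :: "'a \<Rightarrow> 'a" and L' R' :: "'b \<Rightarrow> 'b" and x y :: "('a, 'b) tensor"
  assume lin: "clinear L" "clinear R" "clinear L'" "clinear R'"
    and L: "\<forall>x y. L (x * y) = L x * y" "\<forall>x y. L' (x * y) = L' x * y"
    and R: "\<forall>x y. R (x * y) = x * R y" "\<forall>x y. R' (x * y) = x * R' y"
    and LR: "\<forall>x y. x * L y = R x * y" "\<forall>x y. x * L' y = R' x * y"
  note l = clinear_times_left and r = clinear_times_right and c = clinear_compose
  have tL: "clinear (tensor_map L L')" and tR: "clinear (tensor_map R R')"
    using lin by (simp_all add: clinear_tensor_map)
  note pL = tensor_map_tensor[OF lin(1,3)] and pR = tensor_map_tensor[OF lin(2,4)]
  show "clinear (tensor_map (fst (L, R)) (fst (L', R')))" using tL by simp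
  show "clinear (tensor_map (snd (L, R)) (snd (L', R')))" using tR by simp
  have "tensor_map L L' (x * y) = tensor_map L L' x * y"
    by (rule tensor_ext[OF c[OF r tL] c[OF tL r]], rule tensor_ext[OF c[OF l tL] l])
      (simp add: pL L)
  then show "tensor_map (fst (L, R)) (fst (L', R')) (x * y) = tensor_map (fst (L, R)) (fst (L', R')) x * y" by simp
  have "tensor_map R R' (x * y) = x * tensor_map R R' y"
    by (rule tensor_ext[OF c[OF r tR] r], rule tensor_ext[OF c[OF l tR] c[OF tR l]])
      (simp add: pR R)
  then show "tensor_map (snd (L, R)) (snd (L', R')) (x * y) = x * tensor_map (snd (L, R)) (snd (L', R')) y" by simp
  have "x * tensor_map L L' y = tensor_map R R' x * y"
    by (rule tensor_ext[OF r c[OF tR r]], rule tensor_ext[OF c[OF tL l] l])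
      (simp add: pL pR LR)
  then show "x * tensor_map (fst (L, R)) (fst (L', R')) y = tensor_map (snd (L, R)) (snd (L', R')) x * y" by simp
qed

lift_definition mult_assoc ::
    "(('a::complex_algebra, 'b::complex_algebra) tensor, 'c::complex_algebra) tensor multiplier \<Rightarrow>
      ('a, ('b, 'c) tensor) tensor multiplier"
  is "\<lambda>m. (\<lambda>x. tensor_assoc (fst m (tensor_assoc_inv x)), \<lambda>x. tensor_assoc (snd m (tensor_assoc_inv x)))"
proof (clarify, intro conjI allI)
  fix L R :: "(('a, 'b) tensor, 'c) tensor \<Rightarrow> (('a, 'b) tensor, 'c) tensor" and x y :: "('a, ('b, 'c) tensor) tensor"
  assume lin: "clinear L" "clinear R"
    and L: "\<forall>x y. L (x * y) = L x * y"
    and R: "\<forall>x y. R (x * y) = x * R y"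
    and LR: "\<forall>x y. x * L y = R x * y"
  show "clinear (\<lambda>x. tensor_assoc (fst (L, R) (tensor_assoc_inv x)))"
    and "clinear (\<lambda>x. tensor_assoc (snd (L, R) (tensor_assoc_inv x)))"
    using lin by (auto intro!: clinear_compose[OF clinear_compose[OF clinear_tensor_assoc_inv] clinear_tensor_assoc])
  show "tensor_assoc (fst (L, R) (tensor_assoc_inv (x * y))) = tensor_assoc (fst (L, R) (tensor_assoc_inv x)) * y"
    by (simp add: L tensor_assoc_inv_times tensor_assoc_times)
  show "tensor_assoc (snd (L, R) (tensor_assoc_inv (x * y))) = x * tensor_assoc (snd (L, R) (tensor_assoc_inv y))"
    by (simp add: R tensor_assoc_inv_times tensor_assoc_times)
  have "tensor_assoc (tensor_assoc_inv x * L (tensor_assoc_inv y)) = tensor_assoc (R (tensor_assoc_inv x) * tensor_assoc_inv y)"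
    by (simp add: LR)
  then show "x * tensor_assoc (fst (L, R) (tensor_assoc_inv y)) = tensor_assoc (snd (L, R) (tensor_assoc_inv x)) * y"
    by (simp add: tensor_assoc_times)
qed

section \<open>Coproducts and counits\<close>

definition nondegenerate :: "'a::complex_algebra itself \<Rightarrow> bool"
  where "nondegenerate _ \<longleftrightarrow>
    (\<forall>a::'a. (\<forall>b. a * b = 0) \<longrightarrow> a = 0) \<and> (\<forall>a::'a. (\<forall>b. b * a = 0) \<longrightarrow> a = 0)"

definition idempotent_algebra :: "'a::complex_algebra itself \<Rightarrow> bool"
  where "idempotent_algebra _ \<longleftrightarrow> cspan {a * b | a b :: 'a. True} = UNIV"

type_synonym 'a coproduct_map = "'a \<Rightarrow> ('a, 'a) tensor multiplier"

definition T1 :: "'a::complex_algebra coproduct_map \<Rightarrow> ('a, 'a) tensor \<Rightarrow> ('a, 'a) tensor"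
  where "T1 \<Delta> = tensor_lift (\<lambda>a b. of_mult (\<Delta> a * (1 \<otimes>\<^sub>M mult_of b)))"

definition T2 :: "'a::complex_algebra coproduct_map \<Rightarrow> ('a, 'a) tensor \<Rightarrow> ('a, 'a) tensor"
  where "T2 \<Delta> = tensor_lift (\<lambda>a b. of_mult ((mult_of a \<otimes>\<^sub>M 1) * \<Delta> b))"

text \<open>
  The maps \<open>\<Delta> \<otimes> \<iota>\<close> and \<open>\<iota> \<otimes> \<Delta>\<close>. Threefold tensor products are always bracketed to the right.
\<close>

definition coproduct_left ::
    "'a::complex_algebra coproduct_map \<Rightarrow> ('a, 'a) tensor \<Rightarrow> ('a, ('a, 'a) tensor) tensor multiplier"
  where "coproduct_left \<Delta> = tensor_lift (\<lambda>p q. mult_assoc (\<Delta> p \<otimes>\<^sub>M mult_of q))"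

definition coproduct_right ::
    "'a::complex_algebra coproduct_map \<Rightarrow> ('a, 'a) tensor \<Rightarrow> ('a, ('a, 'a) tensor) tensor multiplier"
  where "coproduct_right \<Delta> = tensor_lift (\<lambda>p q. mult_of p \<otimes>\<^sub>M \<Delta> q)"

definition algebra_hom :: "('a::complex_algebra \<Rightarrow> 'b::complex_algebra) \<Rightarrow> bool"
  where "algebra_hom f \<longleftrightarrow> clinear f \<and> (\<forall>x y. f (x * y) = f x * f y)"

definition coproduct :: "'a::complex_algebra coproduct_map \<Rightarrow> bool"
  where "coproduct \<Delta> \<longleftrightarrow>
    algebra_hom \<Delta> \<and>
    (\<forall>a b. \<Delta> a * (1 \<otimes>\<^sub>M mult_of b) \<in> range mult_of) \<and>
    (\<forall>a b. (mult_of a \<otimes>\<^sub>M 1) * \<Delta> b \<in> range mult_of) \<and>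
    (\<forall>a b c. (mult_of a \<otimes>\<^sub>M 1 \<otimes>\<^sub>M 1) * coproduct_left \<Delta> (T1 \<Delta> (b \<otimes> c)) =
      coproduct_right \<Delta> (T2 \<Delta> (a \<otimes> b)) * (1 \<otimes>\<^sub>M 1 \<otimes>\<^sub>M mult_of c))"

definition tensor_subspace ::
    "'a::complex_vector set \<Rightarrow> 'b::complex_vector set \<Rightarrow> ('a, 'b) tensor set"
  where "tensor_subspace V W = cspan {v \<otimes> w | v w. v \<in> V \<and> w \<in> W}"

definition left_leg :: "'a::complex_algebra coproduct_map \<Rightarrow> 'a set"
  where "left_leg \<Delta> = \<Inter>{V. csubspace V \<and> (\<forall>a b. T1 \<Delta> (a \<otimes> b) \<in> tensor_subspace V UNIV)}"

definition right_leg :: "'a::complex_algebra coproduct_map \<Rightarrow> 'a set"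
  where "right_leg \<Delta> = \<Inter>{W. csubspace W \<and> (\<forall>a b. T2 \<Delta> (a \<otimes> b) \<in> tensor_subspace UNIV W)}"

definition full_coproduct :: "'a::complex_algebra coproduct_map \<Rightarrow> bool"
  where "full_coproduct \<Delta> \<longleftrightarrow> coproduct \<Delta> \<and> left_leg \<Delta> = UNIV \<and> right_leg \<Delta> = UNIV"

text \<open>The maps \<open>\<epsilon> \<otimes> \<iota>\<close> and \<open>\<iota> \<otimes> \<epsilon>\<close>.\<close>

definition slice_left :: "('a::complex_vector \<Rightarrow> complex) \<Rightarrow> ('a, 'b::complex_vector) tensor \<Rightarrow> 'b"
  where "slice_left \<epsilon> = tensor_lift (\<lambda>a b. \<epsilon> a *\<^sub>C b)"

definition slice_right :: "('b::complex_vector \<Rightarrow> complex) \<Rightarrow> ('a::complex_vector, 'b) tensor \<Rightarrow> 'a"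
  where "slice_right \<epsilon> = tensor_lift (\<lambda>a b. \<epsilon> b *\<^sub>C a)"

definition counit :: "'a::complex_algebra coproduct_map \<Rightarrow> ('a \<Rightarrow> complex) \<Rightarrow> bool"
  where "counit \<Delta> \<epsilon> \<longleftrightarrow> clinear \<epsilon> \<and>
    (\<forall>a b. slice_left \<epsilon> (T1 \<Delta> (a \<otimes> b)) = a * b) \<and>
    (\<forall>a b. slice_right \<epsilon> (T2 \<Delta> (a \<otimes> b)) = a * b)"

section \<open>Weak multiplier Hopf algebras\<close>

definition canonical_idempotent ::
    "'a::complex_algebra coproduct_map \<Rightarrow> ('a, 'a) tensor multiplier \<Rightarrow> bool"
  where "canonical_idempotent \<Delta> E \<longleftrightarrow>
    E * E = E \<and> range (T1 \<Delta>) = {E \<rhd> x | x. True} \<and> range (T2 \<Delta>) = {x \<lhd> E | x. True}"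

text \<open>
  \<open>\<Phi>\<close> is an extension of the homomorphism \<open>\<phi> : A \<rightarrow> M(B)\<close> to \<open>M(A)\<close> that sends \<open>1\<close> to \<open>e\<close>.
\<close>

definition hom_extension ::
    "('a::complex_algebra \<Rightarrow> 'b::complex_algebra multiplier) \<Rightarrow> 'b multiplier \<Rightarrow>
      ('a multiplier \<Rightarrow> 'b multiplier) \<Rightarrow> bool"
  where "hom_extension \<phi> e \<Phi> \<longleftrightarrow> algebra_hom \<Phi> \<and> (\<forall>x. \<Phi> (mult_of x) = \<phi> x) \<and> \<Phi> 1 = e"

text \<open>
  Below, \<open>E\<^sub>1\<close> and \<open>E\<^sub>2\<close> are \<open>E \<otimes> 1\<close> and \<open>1 \<otimes> E\<close>, and \<open>\<Phi>\<close> and \<open>\<Psi>\<close> are the extensions of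
  \<open>\<Delta> \<otimes> \<iota>\<close> and \<open>\<iota> \<otimes> \<Delta>\<close> to \<open>M(A \<otimes> A)\<close>. When \<open>E\<close> is the canonical idempotent of a weak
  multiplier Hopf algebra, there is exactly one such \<open>\<Phi>\<close> and one such \<open>\<Psi>\<close>, so the existential
  quantifier only names them.
\<close>

definition idempotent_compatible ::
    "'a::complex_algebra coproduct_map \<Rightarrow> ('a, 'a) tensor multiplier \<Rightarrow> bool"
  where "idempotent_compatible \<Delta> E \<longleftrightarrow>
    (let E\<^sub>1 = mult_assoc (E \<otimes>\<^sub>M 1); E\<^sub>2 = 1 \<otimes>\<^sub>M E in
      \<exists>\<Phi> \<Psi>. hom_extension (coproduct_left \<Delta>) E\<^sub>1 \<Phi> \<and> hom_extension (coproduct_right \<Delta>) E\<^sub>2 \<Psi> \<and>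
        \<Psi> E = \<Phi> E \<and> \<Phi> E = E\<^sub>2 * E\<^sub>1 \<and> E\<^sub>2 * E\<^sub>1 = E\<^sub>1 * E\<^sub>2)"

text \<open>
  The right multipliers of \<open>A \<otimes> A\<^sup>o\<^sup>p\<close> and left multipliers of \<open>A\<^sup>o\<^sup>p \<otimes> A\<close> are both given as
  the linear map \<open>F\<close> that sends \<open>a \<otimes> b\<close> to \<open>(a \<otimes> 1)F(1 \<otimes> b)\<close>.
\<close>

definition twisted_multiplier ::
    "(('a::complex_algebra, 'a) tensor \<Rightarrow> ('a, 'a) tensor) \<Rightarrow> bool"
  where "twisted_multiplier F \<longleftrightarrow> clinear F \<and>
    (\<forall>a a' b b'. F ((a' * a) \<otimes> (b * b')) =
      ((mult_of a' \<otimes>\<^sub>M 1) \<rhd> F (a \<otimes> b)) \<lhd> (1 \<otimes>\<^sub>M mult_of b'))"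

text \<open>\<open>E\<^sub>1\<^sub>3(F\<^sub>1 \<otimes> 1) = E\<^sub>1\<^sub>3(1 \<otimes> E)\<close>, multiplied by \<open>a \<otimes> 1 \<otimes> c\<close> from the left and by
  \<open>1 \<otimes> b \<otimes> d\<close> from the right.\<close>

definition F1_equation ::
    "('a::complex_algebra, 'a) tensor multiplier \<Rightarrow> (('a, 'a) tensor \<Rightarrow> ('a, 'a) tensor) \<Rightarrow> bool"
  where "F1_equation E F\<^sub>1 \<longleftrightarrow> (\<forall>a b c d.
    tensor_assoc (tensor_lift (\<lambda>p q. F\<^sub>1 (p \<otimes> b) \<otimes> (q * d)) ((a \<otimes> c) \<lhd> E)) =
    tensor_lift (\<lambda>p q. p \<otimes> ((1 \<otimes>\<^sub>M mult_of q) \<rhd> E \<rhd> (b \<otimes> d))) ((a \<otimes> c) \<lhd> E))"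

text \<open>\<open>(1 \<otimes> F\<^sub>2)E\<^sub>1\<^sub>3 = (E \<otimes> 1)E\<^sub>1\<^sub>3\<close>, multiplied by \<open>d \<otimes> b \<otimes> 1\<close> from the left and by
  \<open>a \<otimes> 1 \<otimes> c\<close> from the right.\<close>

definition F2_equation ::
    "('a::complex_algebra, 'a) tensor multiplier \<Rightarrow> (('a, 'a) tensor \<Rightarrow> ('a, 'a) tensor) \<Rightarrow> bool"
  where "F2_equation E F\<^sub>2 \<longleftrightarrow> (\<forall>a b c d.
    tensor_lift (\<lambda>p q. (d * p) \<otimes> F\<^sub>2 (b \<otimes> q)) (E \<rhd> (a \<otimes> c)) =
    tensor_assoc (tensor_lift (\<lambda>p q. ((d \<otimes> b) \<lhd> E \<lhd> (mult_of p \<otimes>\<^sub>M 1)) \<otimes> q) (E \<rhd> (a \<otimes> c))))"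

definition weak_multiplier_Hopf_structure ::
    "'a::complex_algebra coproduct_map \<Rightarrow> ('a \<Rightarrow> complex) \<Rightarrow> ('a, 'a) tensor multiplier \<Rightarrow>
      (('a, 'a) tensor \<Rightarrow> ('a, 'a) tensor) \<Rightarrow> (('a, 'a) tensor \<Rightarrow> ('a, 'a) tensor) \<Rightarrow> bool"
  where "weak_multiplier_Hopf_structure \<Delta> \<epsilon> E F\<^sub>1 F\<^sub>2 \<longleftrightarrow>
    nondegenerate TYPE('a) \<and> idempotent_algebra TYPE('a) \<and>
    full_coproduct \<Delta> \<and> counit \<Delta> \<epsilon> \<and>
    canonical_idempotent \<Delta> E \<and> idempotent_compatible \<Delta> E \<and>
    twisted_multiplier F\<^sub>1 \<and> F1_equation E F\<^sub>1 \<and>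
    twisted_multiplier F\<^sub>2 \<and> F2_equation E F\<^sub>2 \<and>
    {x. T1 \<Delta> x = 0} = cspan {a \<otimes> b - F\<^sub>1 (a \<otimes> b) | a b. True} \<and>
    {x. T2 \<Delta> x = 0} = cspan {a \<otimes> b - F\<^sub>2 (a \<otimes> b) | a b. True}"

definition weak_multiplier_Hopf_algebra :: "'a::complex_algebra coproduct_map \<Rightarrow> bool"
  where "weak_multiplier_Hopf_algebra \<Delta> \<longleftrightarrow> (\<exists>\<epsilon> E F\<^sub>1 F\<^sub>2. weak_multiplier_Hopf_structure \<Delta> \<epsilon> E F\<^sub>1 F\<^sub>2)"

definition generalized_inverse ::
    "'a::complex_algebra coproduct_map \<Rightarrow> ('a, 'a) tensor multiplier \<Rightarrow>
      (('a, 'a) tensor \<Rightarrow> ('a, 'a) tensor) \<Rightarrow> (('a, 'a) tensor \<Rightarrow> ('a, 'a) tensor) \<Rightarrow> bool"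
  where "generalized_inverse \<Delta> E F\<^sub>1 R\<^sub>1 \<longleftrightarrow> clinear R\<^sub>1 \<and>
    T1 \<Delta> \<circ> R\<^sub>1 \<circ> T1 \<Delta> = T1 \<Delta> \<and> R\<^sub>1 \<circ> T1 \<Delta> \<circ> R\<^sub>1 = R\<^sub>1 \<and>
    (\<forall>a b. T1 \<Delta> (R\<^sub>1 (a \<otimes> b)) = E \<rhd> (a \<otimes> b)) \<and>
    (\<forall>a b. R\<^sub>1 (T1 \<Delta> (a \<otimes> b)) = F\<^sub>1 (a \<otimes> b))"

text \<open>
  \<open>S a\<close> is the left multiplier \<open>b \<mapsto> S(a)b\<close>. All of \<open>\<epsilon>\<close>, \<open>E\<close>, \<open>F\<^sub>1\<close>, \<open>F\<^sub>2\<close>, \<open>R\<^sub>1\<close>, and hence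
  \<open>S\<close>, are determined by \<open>\<Delta>\<close>.
\<close>

definition antipode :: "'a::complex_algebra coproduct_map \<Rightarrow> 'a \<Rightarrow> 'a \<Rightarrow> 'a"
  where "antipode \<Delta> = (THE S. \<exists>\<epsilon> E F\<^sub>1 F\<^sub>2 R\<^sub>1.
    weak_multiplier_Hopf_structure \<Delta> \<epsilon> E F\<^sub>1 F\<^sub>2 \<and> generalized_inverse \<Delta> E F\<^sub>1 R\<^sub>1 \<and>
    S = (\<lambda>a b. slice_left \<epsilon> (R\<^sub>1 (a \<otimes> b))))"

section \<open>Groupoids and their algebras\<close>

text \<open>
  The groupoid is the set \<open>arrows\<close>, which may be empty or a proper subset of the type. The
  product \<open>p \<cdot> q\<close> is only meaningful for \<open>source p = target q\<close>.
\<close>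

class groupoid =
  fixes arrows :: "'a set"
    and source :: "'a \<Rightarrow> 'a"
    and target :: "'a \<Rightarrow> 'a"
    and gmult :: "'a \<Rightarrow> 'a \<Rightarrow> 'a" (infixl "\<cdot>" 70)
    and ginv :: "'a \<Rightarrow> 'a"
  assumes source_closed: "p \<in> arrows \<Longrightarrow> source p \<in> arrows"
    and target_closed: "p \<in> arrows \<Longrightarrow> target p \<in> arrows"
    and gmult_closed: "p \<in> arrows \<Longrightarrow> q \<in> arrows \<Longrightarrow> source p = target q \<Longrightarrow> p \<cdot> q \<in> arrows"
    and ginv_closed: "p \<in> arrows \<Longrightarrow> ginv p \<in> arrows"
    and source_source: "p \<in> arrows \<Longrightarrow> source (source p) = source p"
    and target_source: "p \<in> arrows \<Longrightarrow> target (source p) = source p"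
    and source_target: "p \<in> arrows \<Longrightarrow> source (target p) = target p"
    and target_target: "p \<in> arrows \<Longrightarrow> target (target p) = target p"
    and source_gmult: "p \<in> arrows \<Longrightarrow> q \<in> arrows \<Longrightarrow> source p = target q \<Longrightarrow> source (p \<cdot> q) = source q"
    and target_gmult: "p \<in> arrows \<Longrightarrow> q \<in> arrows \<Longrightarrow> source p = target q \<Longrightarrow> target (p \<cdot> q) = target p"
    and gmult_assoc: "p \<in> arrows \<Longrightarrow> q \<in> arrows \<Longrightarrow> r \<in> arrows \<Longrightarrow>
      source p = target q \<Longrightarrow> source q = target r \<Longrightarrow> (p \<cdot> q) \<cdot> r = p \<cdot> (q \<cdot> r)"
    and gmult_source: "p \<in> arrows \<Longrightarrow> p \<cdot> source p = p"
    and gmult_target: "p \<in> arrows \<Longrightarrow> target p \<cdot> p = p"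
    and source_ginv: "p \<in> arrows \<Longrightarrow> source (ginv p) = target p"
    and target_ginv: "p \<in> arrows \<Longrightarrow> target (ginv p) = source p"
    and ginv_gmult: "p \<in> arrows \<Longrightarrow> ginv p \<cdot> p = source p"
    and gmult_ginv: "p \<in> arrows \<Longrightarrow> p \<cdot> ginv p = target p"

typedef (overloaded) 'g groupoid_algebra =
    "{x :: 'g::groupoid \<Rightarrow>\<^sub>0 complex. Poly_Mapping.keys x \<subseteq> arrows}"
  by (rule exI[of _ 0]) simp

setup_lifting type_definition_groupoid_algebra

text \<open>The basis element of an arrow.\<close>

lift_definition gen :: "'g::groupoid \<Rightarrow> 'g groupoid_algebra"
  is "\<lambda>p. if p \<in> arrows then Poly_Mapping.single p 1 else 0"
  by simp

instantiation groupoid_algebra :: (groupoid) complex_vector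
begin

lift_definition zero_groupoid_algebra :: "'a groupoid_algebra" is 0 by simp

lift_definition plus_groupoid_algebra :: "'a groupoid_algebra \<Rightarrow> 'a groupoid_algebra \<Rightarrow> 'a groupoid_algebra"
  is "(+)" by (rule order_trans[OF keys_add]) simp

lift_definition minus_groupoid_algebra :: "'a groupoid_algebra \<Rightarrow> 'a groupoid_algebra \<Rightarrow> 'a groupoid_algebra"
  is "(-)" by (rule order_trans[OF keys_diff]) simp

lift_definition uminus_groupoid_algebra :: "'a groupoid_algebra \<Rightarrow> 'a groupoid_algebra"
  is uminus by simp

lift_definition scaleC_groupoid_algebra :: "complex \<Rightarrow> 'a groupoid_algebra \<Rightarrow> 'a groupoid_algebra"
  is scaleC by (auto simp: in_keys_iff subset_iff scaleC_complex_def)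

instance
proof
  fix x y z :: "'a groupoid_algebra" and c d
  show "x + y + z = x + (y + z)" by transfer (rule add.assoc)
  show "x + y = y + x" by transfer (rule add.commute)
  show "0 + x = x" by transfer simp
  show "- x + x = 0" by transfer simp
  show "x - y = x + - y" by transfer simp
  show "c *\<^sub>C (x + y) = c *\<^sub>C x + c *\<^sub>C y" by transfer (rule scaleC_add_right)
  show "(c + d) *\<^sub>C x = c *\<^sub>C x + d *\<^sub>C x" by transfer (rule scaleC_add_left)
  show "c *\<^sub>C (d *\<^sub>C x) = (c * d) *\<^sub>C x" by transfer (rule scaleC_scaleC)
  show "1 *\<^sub>C x = x" by transfer simp
qed

end

text \<open>The linear extension of a map on arrows.\<close>

definition groupoid_lift :: "('g::groupoid \<Rightarrow> 'v::complex_vector) \<Rightarrow> 'g groupoid_algebra \<Rightarrow> 'v"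
  where "groupoid_lift \<phi> x = free_lift \<phi> (Rep_groupoid_algebra x)"

lemma clinear_groupoid_lift: "clinear (groupoid_lift \<phi>)"
  unfolding groupoid_lift_def
  by (rule clinearI) (simp_all add: plus_groupoid_algebra.rep_eq scaleC_groupoid_algebra.rep_eq
      clinear_add[OF clinear_free_lift] clinear_scale[OF clinear_free_lift])

lemma groupoid_lift_gen: "p \<in> arrows \<Longrightarrow> groupoid_lift \<phi> (gen p) = \<phi> p"
  by (simp add: groupoid_lift_def gen.rep_eq)

lemma groupoid_lift_gen_eq: "groupoid_lift gen x = x"
proof -
  have lin: "clinear Rep_groupoid_algebra"
    by (rule clinearI) (simp_all add: plus_groupoid_algebra.rep_eq scaleC_groupoid_algebra.rep_eq)
  have keys: "Poly_Mapping.keys (Rep_groupoid_algebra x) \<subseteq> arrows"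
    using Rep_groupoid_algebra[of x] by simp
  have "Rep_groupoid_algebra (groupoid_lift gen x) =
      (\<Sum>k\<in>Poly_Mapping.keys (Rep_groupoid_algebra x).
        Poly_Mapping.lookup (Rep_groupoid_algebra x) k *\<^sub>C Rep_groupoid_algebra (gen k))"
    by (simp add: groupoid_lift_def free_lift_def clinear_sum[OF lin] clinear_scale[OF lin])
  also have "\<dots> = free_lift (\<lambda>k. Poly_Mapping.single k 1) (Rep_groupoid_algebra x)"
    unfolding free_lift_def using keys by (intro sum.cong) (auto simp: gen.rep_eq)
  also have "\<dots> = Rep_groupoid_algebra x"
    by (rule free_lift_eq[OF clinear_id, symmetric])
  finally show ?thesis by (simp add: Rep_groupoid_algebra_inject)
qed

lemma groupoid_ext:
  fixes f g :: "'g::groupoid groupoid_algebra \<Rightarrow> 'v::complex_vector"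
  assumes "clinear f" "clinear g" "\<And>p. p \<in> arrows \<Longrightarrow> f (gen p) = g (gen p)"
  shows "f x = g x"
proof -
  have keys: "Poly_Mapping.keys (Rep_groupoid_algebra x) \<subseteq> arrows"
    using Rep_groupoid_algebra[of x] by simp
  have "f (groupoid_lift gen x) = g (groupoid_lift gen x)"
    unfolding groupoid_lift_def free_lift_def
    using keys by (auto simp: clinear_sum[OF assms(1)] clinear_sum[OF assms(2)]
        clinear_scale[OF assms(1)] clinear_scale[OF assms(2)] assms(3) intro!: sum.cong)
  then show ?thesis by (simp add: groupoid_lift_gen_eq)
qed

instantiation groupoid_algebra :: (groupoid) complex_algebra
begin

definition times_groupoid_algebra :: "'a groupoid_algebra \<Rightarrow> 'a groupoid_algebra \<Rightarrow> 'a groupoid_algebra"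
  where "x * y =
    groupoid_lift (\<lambda>p. groupoid_lift (\<lambda>q. if source p = target q then gen (p \<cdot> q) else 0) y) x"

instance
proof -
  note gl = clinear_groupoid_lift
  have r: "clinear (\<lambda>x. x * y)" for y :: "'a groupoid_algebra"
    unfolding times_groupoid_algebra_def by (rule gl)
  have gen1: "gen p * y = groupoid_lift (\<lambda>q. if source p = target q then gen (p \<cdot> q) else 0) y"
    if "p \<in> arrows" for p and y :: "'a groupoid_algebra"
    unfolding times_groupoid_algebra_def by (rule groupoid_lift_gen[OF that])
  have gen2: "gen p * gen q = (if source p = target q then gen (p \<cdot> q) else 0)"
    if "p \<in> arrows" "q \<in> arrows" for p q :: 'a
    unfolding gen1[OF that(1)] by (rule groupoid_lift_gen[OF that(2)])
  have l: "clinear (\<lambda>y. x * y)" for x :: "'a groupoid_algebra"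
  proof (rule clinearI)
    fix y z c
    show "x * (y + z) = x * y + x * z"
      by (rule groupoid_ext[OF r clinear_plus_fun[OF r r]]) (simp add: gen1 clinear_add[OF gl])
    show "x * (c *\<^sub>C y) = c *\<^sub>C (x * y)"
      by (rule groupoid_ext[OF r clinear_scale_fun[OF r]]) (simp add: gen1 clinear_scale[OF gl])
  qed
  show "OFCLASS('a groupoid_algebra, complex_algebra_class)"
  proof
    fix x y z :: "'a groupoid_algebra" and c
    show "x * y * z = x * (y * z)"
    proof (rule groupoid_ext[OF clinear_compose[OF r r] r])
      fix p :: 'a assume p: "p \<in> arrows"
      show "gen p * y * z = gen p * (y * z)"
      proof (rule groupoid_ext[OF clinear_compose[OF l r] clinear_compose[OF r l]])
        fix q :: 'a assume q: "q \<in> arrows"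
        show "gen p * gen q * z = gen p * (gen q * z)"
        proof (rule groupoid_ext[OF l clinear_compose[OF l l]])
          fix s :: 'a assume s: "s \<in> arrows"
          show "gen p * gen q * gen s = gen p * (gen q * gen s)"
            using p q s
            by (simp add: gen2 gmult_closed source_gmult target_gmult gmult_assoc
                clinear_zero[OF l] clinear_zero[OF r])
        qed
      qed
    qed
    show "(x + y) * z = x * z + y * z" by (rule clinear_add[OF r])
    show "x * (y + z) = x * y + x * z" by (rule clinear_add[OF l])
    show "(c *\<^sub>C x) * y = c *\<^sub>C (x * y)" by (rule clinear_scale[OF r])
    show "x * (c *\<^sub>C y) = c *\<^sub>C (x * y)" by (rule clinear_scale[OF l])
  qed
qed

end

lemma gen_times_gen:
  "p \<in> arrows \<Longrightarrow> q \<in> arrows \<Longrightarrow> gen p * gen q = (if source p = target q then gen (p \<cdot> q) else 0)"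
  by (simp add: times_groupoid_algebra_def groupoid_lift_gen)

definition groupoid_coproduct :: "'g::groupoid groupoid_algebra coproduct_map"
  where "groupoid_coproduct = groupoid_lift (\<lambda>p. mult_of (gen p \<otimes> gen p))"

lemma groupoid_coproduct_gen: "p \<in> arrows \<Longrightarrow> groupoid_coproduct (gen p) = mult_of (gen p \<otimes> gen p)"
  by (simp add: groupoid_coproduct_def groupoid_lift_gen)

lemma clinear_groupoid_coproduct: "clinear groupoid_coproduct"
  unfolding groupoid_coproduct_def by (rule clinear_groupoid_lift)

end

theory Submission
  imports Defs
begin

text \<open>
  The element \<open>\<lambda>\<^sub>p \<otimes> \<lambda>\<^sub>p\<close> lies in \<open>A \<otimes> A\<close>, so \<open>\<Delta>\<close> is a homomorphism into the algebra
  itself, and everything else acts on the basis. Multiplication by \<open>E\<close> from the left (right)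
  keeps the \<open>\<lambda>\<^sub>p \<otimes> \<lambda>\<^sub>q\<close> with equal targets (sources) and kills the others; \<open>F\<^sub>1 = F\<^sub>2\<close> keeps those
  for which \<open>pq\<close> is defined; \<open>R\<^sub>1\<close> sends \<open>\<lambda>\<^sub>p \<otimes> \<lambda>\<^sub>q\<close> to \<open>\<lambda>\<^sub>p \<otimes> \<lambda>\<^sub>r\<close> with \<open>r = p\<^sup>-\<^sup>1q\<close> when the targets
  agree and to 0 otherwise. Finite sums of units are local units; they give non-degeneracy and the
  extensions of \<open>\<Delta> \<otimes> \<iota>\<close> and \<open>\<iota> \<otimes> \<Delta>\<close> to multipliers. Since \<open>\<epsilon>\<close>, \<open>E\<close>, \<open>F\<^sub>1\<close> and \<open>R\<^sub>1\<close> are determined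
  by \<open>\<Delta>\<close>, the antipode can be read off from this \<open>R\<^sub>1\<close>.
\<close>

section \<open>Multipliers\<close>

lemma mult_left_one [simp]: "1 \<rhd> x = x"
  by transfer simp

lemma mult_right_one [simp]: "x \<lhd> 1 = x"
  by transfer simp

lemma mult_left_mult [simp]: "(m * n) \<rhd> x = m \<rhd> n \<rhd> x"
  by transfer auto

lemma mult_right_mult [simp]: "x \<lhd> (m * n) = x \<lhd> m \<lhd> n"
  by transfer auto

lemma mult_left_add [simp]: "(m + n) \<rhd> x = m \<rhd> x + n \<rhd> x"
  by transfer auto

lemma mult_left_scaleC [simp]: "(c *\<^sub>C m) \<rhd> x = c *\<^sub>C (m \<rhd> x)"
  by transfer auto

lemma mult_right_add [simp]: "x \<lhd> (m + n) = x \<lhd> m + x \<lhd> n"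
  by transfer auto

lemma mult_right_scaleC [simp]: "x \<lhd> (c *\<^sub>C m) = c *\<^sub>C (x \<lhd> m)"
  by transfer auto

lemma mult_left_mult_of [simp]: "mult_of a \<rhd> x = a * x"
  by transfer simp

lemma mult_right_mult_of [simp]: "x \<lhd> mult_of a = x * a"
  by transfer simp

text \<open>Together with its mirror image below: the algebra is a two-sided ideal in its
  multipliers. This makes the products inside \<open>T1\<close> and \<open>T2\<close>
  computable.\<close>

lemma mult_of_times_multiplier: "mult_of a * m = mult_of (a \<lhd> m)"
  by (rule multiplier_eqI) (simp_all add: mult_left_right mult_right_times)

lemma multiplier_times_mult_of: "m * mult_of a = mult_of (m \<rhd> a)"
  by (rule multiplier_eqI) (simp_all add: mult_left_right mult_left_times)

lemma clinear_mult_of: "clinear mult_of"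
  by (rule clinearI; rule multiplier_eqI)
    (simp_all add: distrib_left distrib_right scaleC_times_left scaleC_times_right)

lemma nondegenerateI:
  assumes "\<And>x::'a::complex_algebra. \<exists>e. e * x = x" and "\<And>x::'a. \<exists>e. x * e = x"
  shows "nondegenerate TYPE('a)"
  unfolding nondegenerate_def by (metis assms)

lemma nondegenerate_eq_left:
  assumes "nondegenerate TYPE('a::complex_algebra)" "\<And>z. z * x = z * (y :: 'a)"
  shows "x = y"
proof -
  have "\<forall>z. z * (x - y) = 0" by (simp add: right_diff_distrib assms(2))
  then show ?thesis using assms(1) unfolding nondegenerate_def by (metis eq_iff_diff_eq_0)
qed

lemma nondegenerate_eq_right:
  assumes "nondegenerate TYPE('a::complex_algebra)" "\<And>z. x * z = (y :: 'a) * z"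
  shows "x = y"
proof -
  have "\<forall>z. (x - y) * z = 0" by (simp add: left_diff_distrib assms(2))
  then show ?thesis using assms(1) unfolding nondegenerate_def by (metis eq_iff_diff_eq_0)
qed

text \<open>The identity \<open>x * (m \<rhd> y) = (x \<lhd> m) * y\<close> and non-degeneracy make
  the right action a function of the left one. Later equalities of multipliers are therefore checked
  on one side only.\<close>

lemma multiplier_eqI_left:
  fixes m n :: "'a::complex_algebra multiplier"
  assumes nd: "nondegenerate TYPE('a)" and eq: "\<And>x. m \<rhd> x = n \<rhd> x"
  shows "m = n"
proof (rule multiplier_eqI[OF eq])
  show "x \<lhd> m = x \<lhd> n" for x
    by (rule nondegenerate_eq_right[OF nd]) (simp add: mult_left_right[symmetric] eq)
qed

text \<open>Non-degeneracy makes \<open>mult_of\<close> injective, so the description in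
  \<open>of_mult\<close> has exactly one solution.\<close>

lemma of_mult_mult_of:
  assumes nd: "nondegenerate TYPE('a::complex_algebra)"
  shows "of_mult (mult_of (a :: 'a)) = a"
  unfolding of_mult_def
proof (rule the_equality)
  fix b assume "mult_of b = mult_of a"
  then have "b * z = a * z" for z by (metis mult_left_mult_of)
  then show "b = a" by (rule nondegenerate_eq_right[OF nd])
qed simp

text \<open>Equal ranges on the left give E E' = E', equal ranges on the right give E E' =
  E.\<close>

lemma canonical_idempotent_unique:
  fixes \<Delta> :: "'a::complex_algebra coproduct_map"
  assumes nd: "nondegenerate TYPE(('a, 'a) tensor)"
    and E: "canonical_idempotent \<Delta> E" and E': "canonical_idempotent \<Delta> E'"
  shows "E = E'"
proof (rule multiplier_eqI_left[OF nd])
  have "{E \<rhd> x | x. True} = {E' \<rhd> x | x. True}" "{x \<lhd> E | x. True} = {x \<lhd> E' | x. True}"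
    using E E' by (simp_all add: canonical_idempotent_def)
  then have "\<exists>y. E' \<rhd> x = E \<rhd> y" "\<exists>y. x \<lhd> E = y \<lhd> E'" for x
    by (simp_all add: set_eq_iff) blast+
  moreover have "E \<rhd> E \<rhd> x = E \<rhd> x" "x \<lhd> E' \<lhd> E' = x \<lhd> E'" for x
    using E E' unfolding canonical_idempotent_def by (metis mult_left_mult mult_right_mult)+
  ultimately have *: "E \<rhd> E' \<rhd> x = E' \<rhd> x" "x \<lhd> E \<lhd> E' = x \<lhd> E" for x
    by metis+
  fix x
  have "z * (E \<rhd> x) = z * (E' \<rhd> x)" for z
    by (metis * mult_left_right)
  then show "E \<rhd> x = E' \<rhd> x"
    by (rule nondegenerate_eq_left[OF nd])
qed

text \<open>A double centralizer. \<open>Abs_multiplier\<close> is meaningful here only if (L, R)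
  satisfies the conditions of the type, which the next lemma derives from a single one.\<close>

definition centralizer ::
    "('a::complex_algebra \<Rightarrow> 'a) \<Rightarrow> ('a \<Rightarrow> 'a) \<Rightarrow> 'a multiplier"
  where "centralizer L R = Abs_multiplier (L, R)"

text \<open>Multiplying by an arbitrary element moves every claim about \<open>L\<close> onto
  \<open>R\<close> and back: for example z L(xy) = R(z) xy = z L(x) y. Non-degeneracy then cancels
  z, so linearity and the module laws come for free.\<close>

lemma centralizer:
  fixes L R :: "'a::complex_algebra \<Rightarrow> 'a"
  assumes nd: "nondegenerate TYPE('a)" and LR: "\<And>x y. x * L y = R x * y"
  shows "centralizer L R \<rhd> x = L x" "x \<lhd> centralizer L R = R x"
proof -
  have "clinear L"
    by (rule clinearI; rule nondegenerate_eq_left[OF nd])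
      (simp_all add: LR distrib_left scaleC_times_right)
  moreover have "clinear R"
    by (rule clinearI; rule nondegenerate_eq_right[OF nd])
      (simp_all add: LR[symmetric] distrib_right scaleC_times_left)
  moreover have "L (x * y) = L x * y" for x y
    by (rule nondegenerate_eq_left[OF nd]) (simp add: LR mult.assoc[symmetric])
  moreover have "R (x * y) = x * R y" for x y
    by (rule nondegenerate_eq_right[OF nd]) (simp add: LR[symmetric] mult.assoc)
  ultimately have "Rep_multiplier (centralizer L R) = (L, R)"
    unfolding centralizer_def by (intro Abs_multiplier_inverse) (simp add: LR)
  then show "centralizer L R \<rhd> x = L x" "x \<lhd> centralizer L R = R x"
    by (simp_all add: mult_left.rep_eq mult_right.rep_eq)
qed

section \<open>Local units and extensions of homomorphisms\<close>

text \<open>With a filter, finitely many requirements hold at a common index, and two nets over the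
  same filter can be combined index by index.\<close>

definition local_unit_net :: "'i filter \<Rightarrow> ('i \<Rightarrow> 'a::complex_algebra) \<Rightarrow> bool"
  where "local_unit_net F e \<longleftrightarrow> F \<noteq> bot \<and> (\<forall>x. \<forall>\<^sub>F i in F. e i * x = x \<and> x * e i = x)"

lemma local_unit_netD:
  assumes "local_unit_net F e"
  shows "F \<noteq> bot" "\<forall>\<^sub>F i in F. e i * x = x" "\<forall>\<^sub>F i in F. x * e i = x"
  using assms by (auto simp: local_unit_net_def elim: eventually_mono)

lemma local_unit_net_nondegenerate:
  fixes e :: "'i \<Rightarrow> 'a::complex_algebra"
  assumes "local_unit_net F e"
  shows "nondegenerate TYPE('a)"
  using eventually_happens'[OF local_unit_netD(1,2)[OF assms]]
    eventually_happens'[OF local_unit_netD(1,3)[OF assms]] by (blast intro!: nondegenerateI)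

text \<open>Scalars are absorbed into the left factor, so every tensor is a finite sum of pure
  tensors and no case for scalar multiples arises.\<close>

lemma tensor_induct [case_names tensor add]:
  assumes "\<And>a b. P (a \<otimes> b)" and "\<And>s t. P s \<Longrightarrow> P t \<Longrightarrow> P (s + t)"
  shows "P (t :: ('a::complex_vector, 'b::complex_vector) tensor)"
proof -
  obtain x where t: "t = abs_tensor x"
    by (metis Quotient3_abs_rep[OF Quotient3_tensor])
  have abs: "clinear (abs_tensor :: _ \<Rightarrow> ('a, 'b) tensor)"
    by (rule clinearI) (simp_all add: plus_tensor.abs_eq scaleC_tensor.abs_eq)
  have "abs_tensor (Poly_Mapping.single k 1) = fst k \<otimes> snd k" for k :: "'a \<times> 'b"
    by (simp add: tensor.abs_eq)
  then have "t = (\<Sum>k\<in>Poly_Mapping.keys x. (Poly_Mapping.lookup x k *\<^sub>C fst k) \<otimes> snd k)"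
    using free_lift_eq[OF abs, of x]
    by (simp add: t free_lift_def tensor_scale_left)
  moreover have "P (\<Sum>k\<in>K. (Poly_Mapping.lookup x k *\<^sub>C fst k) \<otimes> snd k)" if "finite K" for K
    using that
  proof (induction K)
    case empty
    \<comment> \<open>The empty sum also has to be a pure tensor.\<close>
    have "0 \<otimes> 0 = (0 :: ('a, 'b) tensor)"
      by (rule clinear_zero[OF cbilinear2[OF cbilinear_tensor]])
    then show ?case using assms(1)[of 0 0] by simp
  qed (simp add: assms)
  ultimately show ?thesis by simp
qed

lemma local_unit_net_tensor:
  assumes "local_unit_net F e" "local_unit_net F e'"
  shows "local_unit_net F (\<lambda>i. e i \<otimes> e' i)"
  unfolding local_unit_net_def
proof (intro conjI allI)
  fix t
  show "\<forall>\<^sub>F i in F. (e i \<otimes> e' i) * t = t \<and> t * (e i \<otimes> e' i) = t"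
  proof (induction t rule: tensor_induct)
    case (tensor a b)
    show ?case
      using local_unit_netD(2,3)[OF assms(1), of a] local_unit_netD(2,3)[OF assms(2), of b]
      by eventually_elim simp
  next
    case (add s t)
    then show ?case by eventually_elim (simp add: distrib_left distrib_right)
  qed
qed (rule local_unit_netD(1)[OF assms(1)])

text \<open>
  The value \<open>m y = D(m e) y\<close> does not depend on the choice of \<open>e\<close>, because
  \<open>x D(m e) y = x D(f m) y\<close> whenever \<open>x D(w) = x D(f w)\<close> for all \<open>w\<close>.
\<close>

lemma hom_extension_exists:
  fixes D :: "'a::complex_algebra \<Rightarrow> 'b::complex_algebra"
  assumes e: "local_unit_net F e" and e': "local_unit_net F e'"
    and D: "algebra_hom D"
    and De: "\<forall>\<^sub>F i in F. \<forall>w. D w * e' i = D (w * e i)"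
    and eD: "\<forall>\<^sub>F i in F. \<forall>w. e' i * D w = D (e i * w)"
  shows "\<exists>\<Phi>. algebra_hom \<Phi> \<and> (\<forall>a. \<Phi> (mult_of a) = mult_of (D a)) \<and>
    (\<forall>m y u. (\<forall>w. D w * y = D (w * u) * y) \<longrightarrow> \<Phi> m \<rhd> y = D (m \<rhd> u) * y)"
proof -
  note nd = local_unit_net_nondegenerate[OF e']
  have lin: "clinear D" and mult: "D (x * y) = D x * D y" for x y
    using D by (simp_all add: algebra_hom_def)
  \<comment> \<open>An \<open>e' i\<close> that fixes y can be inserted in front of y and then
    pulled into \<open>D\<close> by \<open>De\<close>; so u is the matching
    \<open>e i\<close>.\<close>
  have exl: "\<exists>u. \<forall>w. D w * y = D (w * u) * y" for y
  proof -
    obtain i where i: "e' i * y = y" "\<forall>w. D w * e' i = D (w * e i)"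
      using eventually_happens'[OF local_unit_netD(1)[OF e]
          eventually_conj[OF local_unit_netD(2)[OF e', of y] De]] by blast
    have "D w * y = D (w * e i) * y" for w
      using mult.assoc[of "D w" "e' i" y] i by simp
    then show ?thesis by blast
  qed
  have exr: "\<exists>u. \<forall>w. x * D w = x * D (u * w)" for x
  proof -
    obtain i where i: "x * e' i = x" "\<forall>w. e' i * D w = D (e i * w)"
      using eventually_happens'[OF local_unit_netD(1)[OF e]
          eventually_conj[OF local_unit_netD(3)[OF e', of x] eD]] by blast
    have "x * D w = x * D (e i * w)" for w
      using mult.assoc[of x "e' i" "D w"] i by simp
    then show ?thesis by blast
  qed
  obtain l where l: "\<And>y w. D w * y = D (w * l y) * y" using exl by metis
  obtain r where r: "\<And>x w. x * D w = x * D (r x * w)" using exr by metis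
  have mid: "x * (D (m \<rhd> u) * y) = (x * D (r x \<lhd> m)) * y"
    if u: "\<And>w. D w * y = D (w * u) * y" for x y u m
  proof -
    have "x * (D (m \<rhd> u) * y) = x * D (r x * (m \<rhd> u)) * y"
      by (simp add: mult.assoc[symmetric] r[symmetric])
    also have "\<dots> = x * (D ((r x \<lhd> m) * u) * y)"
      by (simp add: mult_left_right mult.assoc)
    also have "\<dots> = (x * D (r x \<lhd> m)) * y"
      by (simp add: u[symmetric] mult.assoc)
    finally show ?thesis .
  qed
  \<comment> \<open>\<open>mid\<close> at u = \<open>l y\<close> is exactly the compatibility
    demanded by \<open>centralizer\<close>.\<close>
  define \<Phi> where "\<Phi> m = centralizer (\<lambda>y. D (m \<rhd> l y) * y) (\<lambda>x. x * D (r x \<lhd> m))" for m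
  have left: "\<Phi> m \<rhd> y = D (m \<rhd> l y) * y" for m y
    unfolding \<Phi>_def by (rule centralizer[OF nd]) (rule mid[OF l])
  have good: "\<Phi> m \<rhd> y = D (m \<rhd> u) * y" if "\<And>w. D w * y = D (w * u) * y" for m y u
    unfolding left by (rule nondegenerate_eq_left[OF nd]) (simp add: mid[OF l] mid[OF that])
  show ?thesis
  proof (intro exI[of _ \<Phi>] conjI allI impI)
    show "\<Phi> m \<rhd> y = D (m \<rhd> u) * y" if "\<forall>w. D w * y = D (w * u) * y" for m y u
      using that by (intro good) blast
    show "\<Phi> (mult_of a) = mult_of (D a)" for a
      by (rule multiplier_eqI_left[OF nd]) (simp add: left l[symmetric])
    show "algebra_hom \<Phi>"
      unfolding algebra_hom_def
    proof (intro conjI allI clinearI; rule multiplier_eqI_left[OF nd])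
      fix m n y
      \<comment> \<open>A left unit of \<open>n \<rhd> l y\<close> is an admissible choice for the
        vector \<open>\<Phi> n \<rhd> y\<close>, so \<open>\<Phi> m\<close> may be evaluated there
        with \<open>e i\<close>, which is then absorbed again.\<close>
      obtain i where i: "e i * (n \<rhd> l y) = n \<rhd> l y"
        using eventually_happens'[OF local_unit_netD(1,2)[OF e]] by blast
      have "D w * (D (n \<rhd> l y) * y) = D (w * e i) * (D (n \<rhd> l y) * y)" for w
        by (metis i mult mult.assoc)
      then have "\<Phi> m \<rhd> \<Phi> n \<rhd> y = D (m \<rhd> e i) * (D (n \<rhd> l y) * y)"
        unfolding left[of n] by (rule good)
      also have "\<dots> = D (m \<rhd> n \<rhd> l y) * y"
        by (metis i mult mult.assoc mult_left_times)
      finally show "\<Phi> (m * n) \<rhd> y = (\<Phi> m * \<Phi> n) \<rhd> y" by (simp add: left)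
    qed (simp_all add: left clinear_add[OF lin] clinear_scale[OF lin] distrib_right scaleC_times_left)
  qed
qed

section \<open>Tensor products of multipliers\<close>

lemma tensor_zero_left [simp]: "0 \<otimes> b = 0"
  by (rule clinear_zero[OF cbilinear1[OF cbilinear_tensor]])

lemma tensor_zero_right [simp]: "a \<otimes> 0 = 0"
  by (rule clinear_zero[OF cbilinear2[OF cbilinear_tensor]])

lemma mult_tensor_left [simp]: "(m \<otimes>\<^sub>M n) \<rhd> (a \<otimes> b) = (m \<rhd> a) \<otimes> (n \<rhd> b)"
  using tensor_map_tensor[OF clinear_mult_left[of m] clinear_mult_left[of n]]
  by (simp add: mult_left.rep_eq mult_tensor.rep_eq)

lemma mult_tensor_right [simp]: "(a \<otimes> b) \<lhd> (m \<otimes>\<^sub>M n) = (a \<lhd> m) \<otimes> (b \<lhd> n)"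
  using tensor_map_tensor[OF clinear_mult_right[of m] clinear_mult_right[of n]]
  by (simp add: mult_right.rep_eq mult_tensor.rep_eq)

lemma mult_assoc_left [simp]: "mult_assoc m \<rhd> x = tensor_assoc (m \<rhd> tensor_assoc_inv x)"
  by (simp add: mult_left.rep_eq mult_assoc.rep_eq)

lemma mult_assoc_right [simp]: "x \<lhd> mult_assoc m = tensor_assoc (tensor_assoc_inv x \<lhd> m)"
  by (simp add: mult_right.rep_eq mult_assoc.rep_eq)

lemma mult_tensor_mult_of: "mult_of a \<otimes>\<^sub>M mult_of b = mult_of (a \<otimes> b)"
proof (rule multiplier_eqI)
  show "(mult_of a \<otimes>\<^sub>M mult_of b) \<rhd> x = mult_of (a \<otimes> b) \<rhd> x" for x
    by (rule tensor_ext[OF clinear_mult_left clinear_mult_left]) simp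
  show "x \<lhd> (mult_of a \<otimes>\<^sub>M mult_of b) = x \<lhd> mult_of (a \<otimes> b)" for x
    by (rule tensor_ext[OF clinear_mult_right clinear_mult_right]) simp
qed

lemma mult_assoc_mult_of: "mult_assoc (mult_of t) = mult_of (tensor_assoc t)"
  by (rule multiplier_eqI) (simp_all add: tensor_assoc_times)

section \<open>Linearity of composite expressions\<close>

lemma clinear_times_left_comp: "clinear f \<Longrightarrow> clinear (\<lambda>x. a * f x :: 'a::complex_algebra)"
  by (rule clinear_compose[OF _ clinear_times_left])

lemma clinear_times_right_comp: "clinear f \<Longrightarrow> clinear (\<lambda>x. f x * a :: 'a::complex_algebra)"
  by (rule clinear_compose[OF _ clinear_times_right])

lemma clinear_tensor_left_comp: "clinear f \<Longrightarrow> clinear (\<lambda>x. f x \<otimes> b)"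
  by (rule clinear_compose[OF _ cbilinear1[OF cbilinear_tensor]])

lemma clinear_tensor_right_comp: "clinear f \<Longrightarrow> clinear (\<lambda>x. a \<otimes> f x)"
  by (rule clinear_compose[OF _ cbilinear2[OF cbilinear_tensor]])

lemma clinear_mult_left_comp: "clinear f \<Longrightarrow> clinear (\<lambda>x. m \<rhd> f x)"
  by (rule clinear_compose[OF _ clinear_mult_left])

lemma clinear_mult_right_comp: "clinear f \<Longrightarrow> clinear (\<lambda>x. f x \<lhd> m)"
  by (rule clinear_compose[OF _ clinear_mult_right])

lemma clinear_tensor_assoc_comp: "clinear f \<Longrightarrow> clinear (\<lambda>x. tensor_assoc (f x))"
  by (rule clinear_compose[OF _ clinear_tensor_assoc])

lemma clinear_mult_left_fun:
  assumes "clinear f"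
  shows "clinear (\<lambda>x. f x \<rhd> y)"
  by (rule clinearI) (simp_all add: clinear_add[OF assms] clinear_scale[OF assms])

lemma clinear_mult_right_fun:
  assumes "clinear f"
  shows "clinear (\<lambda>x. y \<lhd> f x)"
  by (rule clinearI) (simp_all add: clinear_add[OF assms] clinear_scale[OF assms])

lemma clinear_mult_of_comp: "clinear f \<Longrightarrow> clinear (\<lambda>x. mult_of (f x))"
  by (rule clinear_compose[OF _ clinear_mult_of])

lemma clinear_mult_tensor_left:
  assumes f: "clinear f"
  shows "clinear (\<lambda>x. f x \<otimes>\<^sub>M n)"
proof (rule clinearI; rule multiplier_eqI; unfold mult_left_add mult_left_scaleC mult_right_add mult_right_scaleC)
  note l = clinear_mult_left and r = clinear_mult_right
  fix x y t c
  show "(f (x + y) \<otimes>\<^sub>M n) \<rhd> t = (f x \<otimes>\<^sub>M n) \<rhd> t + (f y \<otimes>\<^sub>M n) \<rhd> t"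
    by (rule tensor_ext[OF l clinear_plus_fun[OF l l]]) (simp add: clinear_add[OF f] tensor_add_left)
  show "t \<lhd> (f (x + y) \<otimes>\<^sub>M n) = t \<lhd> (f x \<otimes>\<^sub>M n) + t \<lhd> (f y \<otimes>\<^sub>M n)"
    by (rule tensor_ext[OF r clinear_plus_fun[OF r r]]) (simp add: clinear_add[OF f] tensor_add_left)
  show "(f (c *\<^sub>C x) \<otimes>\<^sub>M n) \<rhd> t = c *\<^sub>C ((f x \<otimes>\<^sub>M n) \<rhd> t)"
    by (rule tensor_ext[OF l clinear_scale_fun[OF l]]) (simp add: clinear_scale[OF f] tensor_scale_left)
  show "t \<lhd> (f (c *\<^sub>C x) \<otimes>\<^sub>M n) = c *\<^sub>C (t \<lhd> (f x \<otimes>\<^sub>M n))"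
    by (rule tensor_ext[OF r clinear_scale_fun[OF r]]) (simp add: clinear_scale[OF f] tensor_scale_left)
qed

lemma clinear_mult_tensor_right:
  assumes f: "clinear f"
  shows "clinear (\<lambda>x. n \<otimes>\<^sub>M f x)"
proof (rule clinearI; rule multiplier_eqI; unfold mult_left_add mult_left_scaleC mult_right_add mult_right_scaleC)
  note l = clinear_mult_left and r = clinear_mult_right
  fix x y t c
  show "(n \<otimes>\<^sub>M f (x + y)) \<rhd> t = (n \<otimes>\<^sub>M f x) \<rhd> t + (n \<otimes>\<^sub>M f y) \<rhd> t"
    by (rule tensor_ext[OF l clinear_plus_fun[OF l l]]) (simp add: clinear_add[OF f] tensor_add_right)
  show "t \<lhd> (n \<otimes>\<^sub>M f (x + y)) = t \<lhd> (n \<otimes>\<^sub>M f x) + t \<lhd> (n \<otimes>\<^sub>M f y)"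
    by (rule tensor_ext[OF r clinear_plus_fun[OF r r]]) (simp add: clinear_add[OF f] tensor_add_right)
  show "(n \<otimes>\<^sub>M f (c *\<^sub>C x)) \<rhd> t = c *\<^sub>C ((n \<otimes>\<^sub>M f x) \<rhd> t)"
    by (rule tensor_ext[OF l clinear_scale_fun[OF l]]) (simp add: clinear_scale[OF f] tensor_scale_right)
  show "t \<lhd> (n \<otimes>\<^sub>M f (c *\<^sub>C x)) = c *\<^sub>C (t \<lhd> (n \<otimes>\<^sub>M f x))"
    by (rule tensor_ext[OF r clinear_scale_fun[OF r]]) (simp add: clinear_scale[OF f] tensor_scale_right)
qed

text \<open>Applied backwards, these rules take a composite term apart. They give linearity in each
  argument separately, which is what reduces multilinear identities to basis elements.\<close>

lemmas clinear_rules = clinear_id clinear_times_left_comp clinear_times_right_comp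
  clinear_tensor_left_comp clinear_tensor_right_comp clinear_mult_left_comp
  clinear_mult_right_comp clinear_tensor_assoc_comp clinear_mult_left_fun clinear_mult_right_fun
  clinear_mult_of_comp clinear_mult_tensor_left clinear_mult_tensor_right
  clinear_plus_fun clinear_scale_fun

section \<open>Slice maps, and kernels as ranges of complementary maps\<close>

lemma cbilinear_slice_left:
  assumes "clinear \<epsilon>"
  shows "cbilinear (\<lambda>a b. \<epsilon> a *\<^sub>C b)"
  by (intro cbilinearI clinearI)
    (simp_all add: clinear_add[OF assms] clinear_scale[OF assms] scaleC_add_left scaleC_add_right
      scaleC_scaleC scaleC_complex_def mult.commute)

lemma cbilinear_slice_right:
  assumes "clinear \<epsilon>"
  shows "cbilinear (\<lambda>a b. \<epsilon> b *\<^sub>C a)"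
  by (intro cbilinearI clinearI)
    (simp_all add: clinear_add[OF assms] clinear_scale[OF assms] scaleC_add_left scaleC_add_right
      scaleC_scaleC scaleC_complex_def mult.commute)

lemma slice_left_tensor: "clinear \<epsilon> \<Longrightarrow> slice_left \<epsilon> (a \<otimes> b) = \<epsilon> a *\<^sub>C b"
  unfolding slice_left_def by (rule tensor_lift_tensor[OF cbilinear_slice_left])

lemma slice_right_tensor: "clinear \<epsilon> \<Longrightarrow> slice_right \<epsilon> (a \<otimes> b) = \<epsilon> b *\<^sub>C a"
  unfolding slice_right_def by (rule tensor_lift_tensor[OF cbilinear_slice_right])

lemma clinear_slice_left: "clinear \<epsilon> \<Longrightarrow> clinear (slice_left \<epsilon>)"
  unfolding slice_left_def by (rule clinear_tensor_lift[OF cbilinear_slice_left])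

lemma clinear_slice_right: "clinear \<epsilon> \<Longrightarrow> clinear (slice_right \<epsilon>)"
  unfolding slice_right_def by (rule clinear_tensor_lift[OF cbilinear_slice_right])

text \<open>Slicing sends v \<otimes> w to a multiple of v. With the counit as functional, this and
  its mirror image bound the legs of the coproduct from below.\<close>

lemma slice_right_subspace:
  assumes "clinear \<epsilon>" "csubspace V" "t \<in> tensor_subspace V UNIV"
  shows "slice_right \<epsilon> t \<in> V"
  using assms(3) unfolding tensor_subspace_def
proof (rule complex_vector.span_induct)
  note lin = clinear_slice_right[OF assms(1)]
  show "csubspace {t. slice_right \<epsilon> t \<in> V}"
    using assms(2) by (simp add: complex_vector.subspace_def clinear_zero[OF lin] clinear_add[OF lin]
        clinear_scale[OF lin])
qed (auto simp: slice_right_tensor[OF assms(1)] intro: complex_vector.subspace_scale[OF assms(2)])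

lemma slice_left_subspace:
  assumes "clinear \<epsilon>" "csubspace V" "t \<in> tensor_subspace UNIV V"
  shows "slice_left \<epsilon> t \<in> V"
  using assms(3) unfolding tensor_subspace_def
proof (rule complex_vector.span_induct)
  note lin = clinear_slice_left[OF assms(1)]
  show "csubspace {t. slice_left \<epsilon> t \<in> V}"
    using assms(2) by (simp add: complex_vector.subspace_def clinear_zero[OF lin] clinear_add[OF lin]
        clinear_scale[OF lin])
qed (auto simp: slice_left_tensor[OF assms(1)] intro: complex_vector.subspace_scale[OF assms(2)])

text \<open>The span is the range of 1 - F. It lies in the kernel because T F = T, and an x in the
  kernel equals x - F x.\<close>

lemma kernel_eq_span:
  assumes T: "clinear T" and F: "clinear F"
    and TF: "\<And>x. T (F x) = T x" and FT: "\<And>x. T x = 0 \<Longrightarrow> F x = 0"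
  shows "{x. T x = 0} = cspan {a \<otimes> b - F (a \<otimes> b) | a b. True}" (is "_ = cspan ?B")
proof (intro equalityI subsetI)
  have "x - F x \<in> cspan ?B" for x
  proof (induction x rule: tensor_induct)
    case (add s t)
    have "s + t - F (s + t) = (s - F s) + (t - F t)" by (simp add: clinear_add[OF F])
    then show ?case using complex_vector.span_add[OF add] by (simp only:)
  next
    case (tensor a b)
    show ?case by (rule complex_vector.span_base) blast
  qed
  then have *: "x - F x \<in> cspan ?B" for x .
  show "x \<in> cspan ?B" if "x \<in> {x. T x = 0}" for x
    using that FT[of x] *[of x] by simp
  fix x assume "x \<in> cspan ?B"
  then have "T x = 0"
  proof (rule complex_vector.span_induct)
    show "csubspace {x. T x = 0}"
      by (simp add: complex_vector.subspace_def clinear_zero[OF T] clinear_add[OF T] clinear_scale[OF T])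
  qed (auto simp: clinear_diff[OF T] TF)
  then show "x \<in> {x. T x = 0}" by simp
qed

section \<open>The groupoid algebra\<close>

text \<open>The unit is a variable with a side condition, so that the rule also applies when the
  unit is written as the target of another arrow.\<close>

lemma gmult_unit_right: "p \<in> arrows \<Longrightarrow> source p = x \<Longrightarrow> p \<cdot> x = p"
  by (metis gmult_source)

lemma gmult_unit_left: "p \<in> arrows \<Longrightarrow> target p = x \<Longrightarrow> x \<cdot> p = p"
  by (metis gmult_target)

text \<open>Of the four cancellation rules, the first two serve to compose \<open>T1\<close> with
  \<open>groupoid_R1\<close>, the last two to compose \<open>T2\<close> with
  \<open>groupoid_R2\<close>.\<close>

lemma gmult_ginv_gmult:
  "p \<in> arrows \<Longrightarrow> q \<in> arrows \<Longrightarrow> target p = target q \<Longrightarrow> p \<cdot> (ginv p \<cdot> q) = q"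
  by (metis ginv_closed gmult_assoc gmult_ginv gmult_target source_ginv target_ginv)

lemma ginv_gmult_gmult:
  "p \<in> arrows \<Longrightarrow> q \<in> arrows \<Longrightarrow> source p = target q \<Longrightarrow> ginv p \<cdot> (p \<cdot> q) = q"
  by (metis ginv_closed gmult_assoc ginv_gmult gmult_target source_ginv)

lemma gmult_ginv_cancel:
  "p \<in> arrows \<Longrightarrow> q \<in> arrows \<Longrightarrow> source p = source q \<Longrightarrow> p \<cdot> ginv q \<cdot> q = p"
  by (metis ginv_closed gmult_assoc ginv_gmult gmult_source source_ginv target_ginv)

lemma gmult_cancel_ginv:
  "p \<in> arrows \<Longrightarrow> q \<in> arrows \<Longrightarrow> source p = target q \<Longrightarrow> p \<cdot> q \<cdot> ginv q = p"
  by (metis ginv_closed gmult_assoc gmult_ginv gmult_source target_ginv)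

lemmas groupoid_simps = source_closed target_closed gmult_closed ginv_closed source_source
  target_source source_target target_target source_gmult target_gmult source_ginv target_ginv
  gmult_unit_left gmult_unit_right gmult_ginv_gmult ginv_gmult_gmult
  gmult_ginv_cancel gmult_cancel_ginv

lemma gen_span: "x \<in> cspan (gen ` arrows)"
proof -
  have "Poly_Mapping.keys (Rep_groupoid_algebra x) \<subseteq> arrows"
    using Rep_groupoid_algebra[of x] by simp
  then have "groupoid_lift gen x \<in> cspan (gen ` arrows)"
    unfolding groupoid_lift_def free_lift_def
    by (intro complex_vector.span_sum complex_vector.span_scale complex_vector.span_base) auto
  then show ?thesis by (simp add: groupoid_lift_gen_eq)
qed

lemma subspace_eq_UNIV:
  assumes "csubspace V" "\<And>p. p \<in> arrows \<Longrightarrow> gen p \<in> V"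
  shows "V = UNIV"
  using complex_vector.span_minimal[OF _ assms(1), of "gen ` arrows"] gen_span assms(2) by auto

section \<open>Linear maps determined by their values on arrows\<close>

lemma groupoid_tensor_ext:
  fixes f g :: "('g::groupoid groupoid_algebra, 'h::groupoid groupoid_algebra) tensor \<Rightarrow> 'v::complex_vector"
  assumes "clinear f" "clinear g"
    and "\<And>p q. p \<in> arrows \<Longrightarrow> q \<in> arrows \<Longrightarrow> f (gen p \<otimes> gen q) = g (gen p \<otimes> gen q)"
  shows "f t = g t"
proof (rule tensor_ext[OF assms(1,2)])
  note c = clinear_compose[OF cbilinear2[OF cbilinear_tensor]]
    clinear_compose[OF cbilinear1[OF cbilinear_tensor]]
  show "f (a \<otimes> b) = g (a \<otimes> b)" for a b
    by (rule groupoid_ext[OF c(2)[OF assms(1)] c(2)[OF assms(2)]],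
        rule groupoid_ext[OF c(1)[OF assms(1)] c(1)[OF assms(2)]]) (rule assms(3))
qed

lemma groupoid_tensor3_ext:
  fixes f g :: "('g::groupoid groupoid_algebra, ('h::groupoid groupoid_algebra,
    'k::groupoid groupoid_algebra) tensor) tensor \<Rightarrow> 'v::complex_vector"
  assumes "clinear f" "clinear g"
    and "\<And>p q r. p \<in> arrows \<Longrightarrow> q \<in> arrows \<Longrightarrow> r \<in> arrows \<Longrightarrow>
      f (gen p \<otimes> gen q \<otimes> gen r) = g (gen p \<otimes> gen q \<otimes> gen r)"
  shows "f t = g t"
proof (rule tensor_ext[OF assms(1,2)])
  note c = clinear_compose[OF cbilinear2[OF cbilinear_tensor]]
    clinear_compose[OF cbilinear1[OF cbilinear_tensor]]
  show "f (a \<otimes> b) = g (a \<otimes> b)" for a b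
    by (rule groupoid_ext[OF c(2)[OF assms(1)] c(2)[OF assms(2)]],
        rule groupoid_tensor_ext[OF c(1)[OF assms(1)] c(1)[OF assms(2)]]) (rule assms(3))
qed

text \<open>Linearity in a parameter is what allows lifts to be nested in
  \<open>groupoid_lift2\<close>.\<close>

lemma clinear_groupoid_lift_param:
  assumes "\<And>p. clinear (\<lambda>z. \<phi> z p)"
  shows "clinear (\<lambda>z. groupoid_lift (\<phi> z) x)"
proof (rule clinearI)
  note l = clinear_groupoid_lift
  show "groupoid_lift (\<phi> (y + z)) x = groupoid_lift (\<phi> y) x + groupoid_lift (\<phi> z) x" for y z
    by (rule groupoid_ext[OF l clinear_plus_fun[OF l l]])
      (simp add: groupoid_lift_gen clinear_add[OF assms])
  show "groupoid_lift (\<phi> (c *\<^sub>C z)) x = c *\<^sub>C groupoid_lift (\<phi> z) x" for c z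
    by (rule groupoid_ext[OF l clinear_scale_fun[OF l]])
      (simp add: groupoid_lift_gen clinear_scale[OF assms])
qed

definition groupoid_lift2 :: "('g::groupoid \<Rightarrow> 'h::groupoid \<Rightarrow> 'v::complex_vector) \<Rightarrow>
    ('g groupoid_algebra, 'h groupoid_algebra) tensor \<Rightarrow> 'v"
  where "groupoid_lift2 \<phi> = tensor_lift (\<lambda>a b. groupoid_lift (\<lambda>p. groupoid_lift (\<phi> p) b) a)"

lemma cbilinear_groupoid_lift2: "cbilinear (\<lambda>a b. groupoid_lift (\<lambda>p. groupoid_lift (\<phi> p) b) a)"
  by (intro cbilinearI clinear_groupoid_lift_param clinear_groupoid_lift)

lemma clinear_groupoid_lift2: "clinear (groupoid_lift2 \<phi>)"
  unfolding groupoid_lift2_def by (rule clinear_tensor_lift[OF cbilinear_groupoid_lift2])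

lemma groupoid_lift2_gen:
  "p \<in> arrows \<Longrightarrow> q \<in> arrows \<Longrightarrow> groupoid_lift2 \<phi> (gen p \<otimes> gen q) = \<phi> p q"
  by (simp add: groupoid_lift2_def tensor_lift_tensor[OF cbilinear_groupoid_lift2] groupoid_lift_gen)

section \<open>Local units\<close>

text \<open>A unit is its own target, so the image of \<open>target\<close> is the set of all
  units.\<close>

abbreviation unit_sets :: "'g::groupoid set filter"
  where "unit_sets \<equiv> finite_subsets_at_top (target ` arrows)"

text \<open>The only unit that composes with p on the left is its target, and on the right its
  source, so at most one summand survives.\<close>

lemma sum_units_gen:
  assumes "finite U" "U \<subseteq> target ` arrows" "p \<in> arrows"
  shows "sum gen U * gen p = (if target p \<in> U then gen p else 0)"
    and "gen p * sum gen U = (if source p \<in> U then gen p else 0)"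
proof -
  have "gen u * gen p = (if u = target p then gen p else 0)"
    "gen p * gen u = (if u = source p then gen p else 0)" if "u \<in> U" for u
    using that assms(2,3) by (auto simp: gen_times_gen groupoid_simps)
  then show "sum gen U * gen p = (if target p \<in> U then gen p else 0)"
    "gen p * sum gen U = (if source p \<in> U then gen p else 0)"
    using assms(1) by (simp_all add: sum_distrib_left sum_distrib_right)
qed

text \<open>The elements that are eventually fixed on both sides form a subspace, and a basis
  element is fixed as soon as U contains its source and target.\<close>

lemma local_unit_net_groupoid:
  "local_unit_net unit_sets (sum gen :: 'g::groupoid set \<Rightarrow> 'g groupoid_algebra)"
  unfolding local_unit_net_def
proof (intro conjI allI)
  fix x :: "'g groupoid_algebra"
  let ?P = "\<lambda>x. \<forall>\<^sub>F U in unit_sets. sum gen U * x = x \<and> x * sum gen U = x"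
  have "{x. ?P x} = (UNIV :: 'g groupoid_algebra set)"
  proof (rule subspace_eq_UNIV)
    show "csubspace {x. ?P x}"
      unfolding complex_vector.subspace_def
    proof (intro conjI allI ballI)
      show "x + y \<in> {x. ?P x}" if "x \<in> {x. ?P x}" "y \<in> {x. ?P x}" for x y
        using that unfolding mem_Collect_eq by eventually_elim (simp add: distrib_left distrib_right)
      show "c *\<^sub>C x \<in> {x. ?P x}" if "x \<in> {x. ?P x}" for c x
        using that unfolding mem_Collect_eq
        by eventually_elim (simp add: scaleC_times_left scaleC_times_right)
    qed simp
    fix p :: 'g assume p: "p \<in> arrows"
    \<comment> \<open>The filter sees only subsets of the image of \<open>target\<close>; a source
      belongs to it as its own target.\<close>
    then have "source p \<in> target ` arrows" by (metis imageI source_closed target_source)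
    then show "gen p \<in> {x. ?P x}"
      using p by (auto simp: eventually_finite_subsets_at_top sum_units_gen
          intro!: exI[of _ "{source p, target p}"])
  qed
  then show "?P x" by blast
qed simp

lemmas local_unit_net_groupoid2 = local_unit_net_tensor[OF local_unit_net_groupoid local_unit_net_groupoid]
lemmas local_unit_net_groupoid3 = local_unit_net_tensor[OF local_unit_net_groupoid local_unit_net_groupoid2]
lemmas nondegenerate_groupoid = local_unit_net_nondegenerate[OF local_unit_net_groupoid]
lemmas nondegenerate_groupoid2 = local_unit_net_nondegenerate[OF local_unit_net_groupoid2]
lemmas nondegenerate_groupoid3 = local_unit_net_nondegenerate[OF local_unit_net_groupoid3]

lemma idempotent_groupoid_algebra: "idempotent_algebra TYPE('g::groupoid groupoid_algebra)"
  unfolding idempotent_algebra_def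
proof (rule subspace_eq_UNIV)
  fix p :: 'g assume "p \<in> arrows"
  then have "gen p = gen p * gen (source p)" by (simp add: gen_times_gen groupoid_simps)
  then show "gen p \<in> cspan {a * b | a b :: 'g groupoid_algebra. True}"
    by (intro complex_vector.span_base) blast
qed simp

section \<open>The coproduct\<close>

definition diag :: "'g::groupoid groupoid_algebra \<Rightarrow> ('g groupoid_algebra, 'g groupoid_algebra) tensor"
  where "diag = groupoid_lift (\<lambda>p. gen p \<otimes> gen p)"

lemma clinear_diag: "clinear diag"
  unfolding diag_def by (rule clinear_groupoid_lift)

lemma diag_gen: "p \<in> arrows \<Longrightarrow> diag (gen p) = gen p \<otimes> gen p"
  by (simp add: diag_def groupoid_lift_gen)

lemma groupoid_coproduct_eq: "groupoid_coproduct a = mult_of (diag a)"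
  by (rule groupoid_ext[OF clinear_groupoid_coproduct clinear_compose[OF clinear_diag clinear_mult_of]])
    (simp add: groupoid_coproduct_gen diag_gen)

text \<open>If pq is undefined, both sides vanish on the basis, since each tensor leg contains the
  same undefined product.\<close>

lemma diag_times: "diag (a * b) = diag a * diag b"
proof (rule groupoid_ext[OF clinear_compose[OF clinear_times_right clinear_diag]
      clinear_compose[OF clinear_diag clinear_times_right]])
  show "diag (gen p * b) = diag (gen p) * diag b" if "p \<in> arrows" for p
    by (rule groupoid_ext[OF clinear_compose[OF clinear_times_left clinear_diag]
          clinear_compose[OF clinear_diag clinear_times_left]])
      (use that in \<open>simp add: gen_times_gen diag_gen groupoid_simps clinear_zero[OF clinear_diag]\<close>)
qed

text \<open>The product under \<open>of_mult\<close> is the image of an element that depends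
  linearly on a and b, so the description can be eliminated and \<open>tensor_lift\<close>
  evaluated.\<close>

lemma cbilinear_T1: "cbilinear (\<lambda>a b. of_mult (groupoid_coproduct a * (1 \<otimes>\<^sub>M mult_of b)))"
  unfolding groupoid_coproduct_eq mult_of_times_multiplier of_mult_mult_of[OF nondegenerate_groupoid2]
  by (intro cbilinearI clinear_rules clinear_diag)

lemma cbilinear_T2: "cbilinear (\<lambda>a b. of_mult ((mult_of a \<otimes>\<^sub>M 1) * groupoid_coproduct b))"
  unfolding groupoid_coproduct_eq multiplier_times_mult_of of_mult_mult_of[OF nondegenerate_groupoid2]
  by (intro cbilinearI clinear_rules clinear_diag)

lemma clinear_T1: "clinear (T1 groupoid_coproduct)"
  unfolding T1_def by (rule clinear_tensor_lift[OF cbilinear_T1])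

lemma clinear_T2: "clinear (T2 groupoid_coproduct)"
  unfolding T2_def by (rule clinear_tensor_lift[OF cbilinear_T2])

lemma T1_gen: "p \<in> arrows \<Longrightarrow> T1 groupoid_coproduct (gen p \<otimes> b) = gen p \<otimes> (gen p * b)"
  unfolding T1_def tensor_lift_tensor[OF cbilinear_T1]
  by (simp add: groupoid_coproduct_eq mult_of_times_multiplier of_mult_mult_of[OF nondegenerate_groupoid2] diag_gen)

lemma T2_gen: "q \<in> arrows \<Longrightarrow> T2 groupoid_coproduct (a \<otimes> gen q) = (a * gen q) \<otimes> gen q"
  unfolding T2_def tensor_lift_tensor[OF cbilinear_T2]
  by (simp add: groupoid_coproduct_eq multiplier_times_mult_of of_mult_mult_of[OF nondegenerate_groupoid2] diag_gen)

section \<open>Threefold tensors and coassociativity\<close>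

definition diag_left :: "('g::groupoid groupoid_algebra, 'g groupoid_algebra) tensor \<Rightarrow>
    ('g groupoid_algebra, ('g groupoid_algebra, 'g groupoid_algebra) tensor) tensor"
  where "diag_left = groupoid_lift2 (\<lambda>p q. gen p \<otimes> gen p \<otimes> gen q)"

definition diag_right :: "('g::groupoid groupoid_algebra, 'g groupoid_algebra) tensor \<Rightarrow>
    ('g groupoid_algebra, ('g groupoid_algebra, 'g groupoid_algebra) tensor) tensor"
  where "diag_right = groupoid_lift2 (\<lambda>p q. gen p \<otimes> gen q \<otimes> gen q)"

lemma clinear_diag_left: "clinear diag_left"
  unfolding diag_left_def by (rule clinear_groupoid_lift2)

lemma clinear_diag_right: "clinear diag_right"
  unfolding diag_right_def by (rule clinear_groupoid_lift2)

lemma diag_left_gen: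
  "p \<in> arrows \<Longrightarrow> q \<in> arrows \<Longrightarrow> diag_left (gen p \<otimes> gen q) = gen p \<otimes> gen p \<otimes> gen q"
  by (simp add: diag_left_def groupoid_lift2_gen)

lemma diag_right_gen:
  "p \<in> arrows \<Longrightarrow> q \<in> arrows \<Longrightarrow> diag_right (gen p \<otimes> gen q) = gen p \<otimes> gen q \<otimes> gen q"
  by (simp add: diag_right_def groupoid_lift2_gen)

lemma algebra_hom_groupoid_lift2:
  fixes \<phi> :: "'g::groupoid \<Rightarrow> 'h::groupoid \<Rightarrow> 'v::complex_algebra"
  assumes \<phi>: "\<And>p q p' q'. p \<in> arrows \<Longrightarrow> q \<in> arrows \<Longrightarrow> p' \<in> arrows \<Longrightarrow> q' \<in> arrows \<Longrightarrow> \<phi> p q * \<phi> p' q' =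
    (if source p = target p' \<and> source q = target q' then \<phi> (p \<cdot> p') (q \<cdot> q') else 0)"
  shows "algebra_hom (groupoid_lift2 \<phi>)" (is "algebra_hom ?f")
  unfolding algebra_hom_def
proof (intro conjI allI clinear_groupoid_lift2)
  note lin = clinear_groupoid_lift2[of \<phi>]
  show "?f (s * t) = ?f s * ?f t" for s t
  proof (rule groupoid_tensor_ext[OF clinear_compose[OF clinear_times_right lin]
        clinear_compose[OF lin clinear_times_right]])
    fix p :: 'g and q :: 'h assume pq: "p \<in> arrows" "q \<in> arrows"
    show "?f ((gen p \<otimes> gen q) * t) = ?f (gen p \<otimes> gen q) * ?f t"
      by (rule groupoid_tensor_ext[OF clinear_compose[OF clinear_times_left lin]
          clinear_compose[OF lin clinear_times_left]])
        (simp add: pq \<phi> gen_times_gen groupoid_lift2_gen groupoid_simps clinear_zero[OF lin])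
  qed
qed

lemma algebra_hom_diag_left: "algebra_hom diag_left"
  unfolding diag_left_def by (rule algebra_hom_groupoid_lift2) (simp add: gen_times_gen)

lemma algebra_hom_diag_right: "algebra_hom diag_right"
  unfolding diag_right_def by (rule algebra_hom_groupoid_lift2) (simp add: gen_times_gen)

lemma cbilinear_coproduct_left:
  "cbilinear (\<lambda>p q. mult_assoc (groupoid_coproduct p \<otimes>\<^sub>M mult_of q))"
  unfolding groupoid_coproduct_eq mult_tensor_mult_of mult_assoc_mult_of
  by (intro cbilinearI clinear_rules clinear_diag)

lemma cbilinear_coproduct_right: "cbilinear (\<lambda>p q. mult_of p \<otimes>\<^sub>M groupoid_coproduct q)"
  unfolding groupoid_coproduct_eq mult_tensor_mult_of
  by (intro cbilinearI clinear_rules clinear_diag)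

lemma coproduct_left_eq: "coproduct_left groupoid_coproduct t = mult_of (diag_left t)"
  unfolding coproduct_left_def
  by (rule groupoid_tensor_ext[OF clinear_tensor_lift[OF cbilinear_coproduct_left]
        clinear_compose[OF clinear_diag_left clinear_mult_of]])
    (subst tensor_lift_tensor[OF cbilinear_coproduct_left], simp add: groupoid_coproduct_eq
      mult_tensor_mult_of mult_assoc_mult_of diag_gen diag_left_gen)

lemma coproduct_right_eq: "coproduct_right groupoid_coproduct t = mult_of (diag_right t)"
  unfolding coproduct_right_def
  by (rule groupoid_tensor_ext[OF clinear_tensor_lift[OF cbilinear_coproduct_right]
        clinear_compose[OF clinear_diag_right clinear_mult_of]])
    (subst tensor_lift_tensor[OF cbilinear_coproduct_right], simp add: groupoid_coproduct_eq
      mult_tensor_mult_of diag_gen diag_right_gen)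
lemma coproduct_groupoid: "coproduct (groupoid_coproduct :: 'g::groupoid groupoid_algebra coproduct_map)"
  unfolding coproduct_def algebra_hom_def
proof (intro conjI allI clinear_groupoid_coproduct)
  fix a b c :: "'g groupoid_algebra"
  show "groupoid_coproduct (a * b) = groupoid_coproduct a * groupoid_coproduct b"
    by (simp add: groupoid_coproduct_eq diag_times multiplier_times_mult_of)
  show "groupoid_coproduct a * (1 \<otimes>\<^sub>M mult_of b) \<in> range mult_of"
    by (simp add: groupoid_coproduct_eq mult_of_times_multiplier)
  show "(mult_of a \<otimes>\<^sub>M 1) * groupoid_coproduct b \<in> range mult_of"
    by (simp add: groupoid_coproduct_eq multiplier_times_mult_of)
  let ?L = "\<lambda>a b c. (mult_of a \<otimes>\<^sub>M 1 \<otimes>\<^sub>M 1) \<rhd> diag_left (T1 groupoid_coproduct (b \<otimes> c))"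
  let ?R = "\<lambda>a b c. diag_right (T2 groupoid_coproduct (a \<otimes> b)) \<lhd> (1 \<otimes>\<^sub>M 1 \<otimes>\<^sub>M mult_of c)"
  note lin = clinear_rules clinear_compose[OF _ clinear_diag_left] clinear_compose[OF _ clinear_diag_right]
    clinear_compose[OF _ clinear_T1] clinear_compose[OF _ clinear_T2]
  have L: "clinear (\<lambda>a. ?L a b c)" "clinear (\<lambda>b. ?L a b c)" "clinear (\<lambda>c. ?L a b c)"
    and R: "clinear (\<lambda>a. ?R a b c)" "clinear (\<lambda>b. ?R a b c)" "clinear (\<lambda>c. ?R a b c)" for a b c
    by (intro lin)+
  \<comment> \<open>Both sides are \<lambda>_pq \<otimes> \<lambda>_q \<otimes> \<lambda>_qr if the
    two products are defined, and 0 otherwise. Linearity then frees the arguments one by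
    one.\<close>
  have "?L (gen p) (gen q) (gen r) = ?R (gen p) (gen q) (gen r)"
    if "p \<in> arrows" "q \<in> arrows" "r \<in> arrows" for p q r :: 'g
    using that by (simp add: T1_gen T2_gen gen_times_gen diag_left_gen diag_right_gen
        groupoid_simps clinear_zero[OF clinear_diag_left] clinear_zero[OF clinear_diag_right]
        clinear_zero[OF clinear_mult_left] clinear_zero[OF clinear_mult_right])
  then have "?L (gen p) (gen q) c = ?R (gen p) (gen q) c" if "p \<in> arrows" "q \<in> arrows" for p q :: 'g
    by (rule groupoid_ext[OF L(3) R(3)]) (use that in simp_all)
  then have "?L (gen p) b c = ?R (gen p) b c" if "p \<in> arrows" for p :: 'g
    by (rule groupoid_ext[OF L(2) R(2)]) (use that in simp_all)
  then have "?L a b c = ?R a b c"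
    by (rule groupoid_ext[OF L(1) R(1)])
  then show "(mult_of a \<otimes>\<^sub>M 1 \<otimes>\<^sub>M 1) * coproduct_left groupoid_coproduct (T1 groupoid_coproduct (b \<otimes> c)) =
      coproduct_right groupoid_coproduct (T2 groupoid_coproduct (a \<otimes> b)) * (1 \<otimes>\<^sub>M 1 \<otimes>\<^sub>M mult_of c)"
    by (simp add: coproduct_left_eq coproduct_right_eq multiplier_times_mult_of mult_of_times_multiplier)
qed

section \<open>Counit and fullness\<close>

definition groupoid_counit :: "'g::groupoid groupoid_algebra \<Rightarrow> complex"
  where "groupoid_counit = groupoid_lift (\<lambda>p. 1)"

lemma clinear_groupoid_counit: "clinear groupoid_counit"
  unfolding groupoid_counit_def by (rule clinear_groupoid_lift)

lemma groupoid_counit_gen: "p \<in> arrows \<Longrightarrow> groupoid_counit (gen p) = 1"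
  by (simp add: groupoid_counit_def groupoid_lift_gen)

text \<open>Slicing \<open>T1\<close> at \<open>gen p \<otimes> b\<close> gives
  \<open>gen p * b\<close> scaled by the value of \<epsilon> at \<open>gen p\<close>. The forward
  direction is the uniqueness of the counit, used for the antipode.\<close>

lemma counit_iff:
  "counit groupoid_coproduct \<epsilon> \<longleftrightarrow> clinear \<epsilon> \<and> (\<forall>p\<in>(arrows :: 'g::groupoid set). \<epsilon> (gen p) = 1)"
  (is "_ = (_ \<and> ?one)")
proof (cases "clinear \<epsilon>")
  case lin: True
  note c = clinear_compose[OF clinear_tensor_left_comp[OF clinear_id] clinear_compose[OF clinear_T1 clinear_slice_left[OF lin]]]
    clinear_compose[OF clinear_tensor_right_comp[OF clinear_id] clinear_compose[OF clinear_T2 clinear_slice_right[OF lin]]]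
  have T1: "slice_left \<epsilon> (T1 groupoid_coproduct (gen p \<otimes> b)) = \<epsilon> (gen p) *\<^sub>C (gen p * b)"
    and T2: "slice_right \<epsilon> (T2 groupoid_coproduct (b \<otimes> gen p)) = \<epsilon> (gen p) *\<^sub>C (b * gen p)"
    if "p \<in> arrows" for p :: 'g and b
    by (simp_all add: T1_gen T2_gen that slice_left_tensor[OF lin] slice_right_tensor[OF lin])
  show ?thesis
  proof
    assume "counit groupoid_coproduct \<epsilon>"
    then have *: "slice_left \<epsilon> (T1 groupoid_coproduct (a \<otimes> b)) = a * b" for a b
      by (simp add: counit_def)
    have "\<epsilon> (gen p) = 1" if p: "p \<in> arrows" for p :: 'g
    proof -
      have "\<epsilon> (gen p) *\<^sub>C gen p = gen p"
        using T1[OF p, of "gen (source p)"] *[of "gen p" "gen (source p)"] p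
        by (simp add: gen_times_gen groupoid_simps)
      \<comment> \<open>A functional with value 1 on \<open>gen p\<close> reads off the
        scalar.\<close>
      then have "groupoid_counit (\<epsilon> (gen p) *\<^sub>C gen p) = groupoid_counit (gen p)" by simp
      then show ?thesis
        by (simp add: clinear_scale[OF clinear_groupoid_counit] groupoid_counit_gen p scaleC_complex_def)
    qed
    then show "clinear \<epsilon> \<and> ?one" using lin by simp
  next
    assume "clinear \<epsilon> \<and> ?one"
    then have one: "\<And>p. p \<in> arrows \<Longrightarrow> \<epsilon> (gen p) = 1" by blast
    have "slice_left \<epsilon> (T1 groupoid_coproduct (a \<otimes> b)) = a * b" for a b
      by (rule groupoid_ext[OF c(1) clinear_times_right]) (simp add: T1 one)
    moreover have "slice_right \<epsilon> (T2 groupoid_coproduct (a \<otimes> b)) = a * b" for a b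
      by (rule groupoid_ext[OF c(2) clinear_times_left]) (simp add: T2 one)
    ultimately show "counit groupoid_coproduct \<epsilon>" using lin by (simp add: counit_def)
  qed
qed (simp add: counit_def)

lemma groupoid_counit: "counit groupoid_coproduct groupoid_counit"
  using counit_iff[of groupoid_counit] clinear_groupoid_counit groupoid_counit_gen by blast

text \<open>With a suitable unit as the other argument, \<open>T1\<close> and \<open>T2\<close> both
  produce \<open>gen p \<otimes> gen p\<close>, whose slice by the counit is \<open>gen p\<close>.
  Hence every admissible subspace contains the basis.\<close>

lemma full_groupoid_coproduct:
  "full_coproduct (groupoid_coproduct :: 'g::groupoid groupoid_algebra coproduct_map)"
  unfolding full_coproduct_def left_leg_def right_leg_def
proof (intro conjI coproduct_groupoid)
  note lin = clinear_groupoid_counit[where 'a = 'g]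
  have "V = UNIV" if V: "csubspace V" "\<And>a b. T1 groupoid_coproduct (a \<otimes> b) \<in> tensor_subspace V UNIV"
    for V :: "'g groupoid_algebra set"
  proof (rule subspace_eq_UNIV[OF V(1)])
    fix p :: 'g assume p: "p \<in> arrows"
    show "gen p \<in> V"
      using slice_right_subspace[OF lin V(1) V(2)[of "gen p" "gen (source p)"]]
      by (simp add: p T1_gen gen_times_gen groupoid_simps slice_right_tensor[OF lin] groupoid_counit_gen)
  qed
  then show "\<Inter>{V. csubspace V \<and> (\<forall>a b. T1 groupoid_coproduct (a \<otimes> b) \<in> tensor_subspace V UNIV)} =
      (UNIV :: 'g groupoid_algebra set)"
    by blast
  have "V = UNIV" if V: "csubspace V" "\<And>a b. T2 groupoid_coproduct (a \<otimes> b) \<in> tensor_subspace UNIV V"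
    for V :: "'g groupoid_algebra set"
  proof (rule subspace_eq_UNIV[OF V(1)])
    fix p :: 'g assume p: "p \<in> arrows"
    show "gen p \<in> V"
      using slice_left_subspace[OF lin V(1) V(2)[of "gen (target p)" "gen p"]]
      by (simp add: p T2_gen gen_times_gen groupoid_simps slice_left_tensor[OF lin] groupoid_counit_gen)
  qed
  then show "\<Inter>{V. csubspace V \<and> (\<forall>a b. T2 groupoid_coproduct (a \<otimes> b) \<in> tensor_subspace UNIV V)} =
      (UNIV :: 'g groupoid_algebra set)"
    by blast
qed

section \<open>The canonical idempotent\<close>

definition same_target where
  "same_target = groupoid_lift2 (\<lambda>p q. if target p = target q then gen p \<otimes> gen q else 0)"

definition same_source where
  "same_source = groupoid_lift2 (\<lambda>p q. if source p = source q then gen p \<otimes> gen q else 0)"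

lemma clinear_same_target: "clinear same_target"
  unfolding same_target_def by (rule clinear_groupoid_lift2)

lemma clinear_same_source: "clinear same_source"
  unfolding same_source_def by (rule clinear_groupoid_lift2)

lemma same_target_gen: "p \<in> arrows \<Longrightarrow> q \<in> arrows \<Longrightarrow>
    same_target (gen p \<otimes> gen q) = (if target p = target q then gen p \<otimes> gen q else 0)"
  by (simp add: same_target_def groupoid_lift2_gen)

lemma same_source_gen: "p \<in> arrows \<Longrightarrow> q \<in> arrows \<Longrightarrow>
    same_source (gen p \<otimes> gen q) = (if source p = source q then gen p \<otimes> gen q else 0)"
  by (simp add: same_source_def groupoid_lift2_gen)

text \<open>Formally the sum of \<lambda>_u \<otimes> \<lambda>_u over all units u. This sum may be
  infinite, hence the description by its two actions.\<close>

definition groupoid_idempotent ::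
    "('g::groupoid groupoid_algebra, 'g groupoid_algebra) tensor multiplier"
  where "groupoid_idempotent = centralizer same_target same_source"

lemma groupoid_idempotent:
  "groupoid_idempotent \<rhd> x = same_target x" "x \<lhd> groupoid_idempotent = same_source x"
proof -
  \<comment> \<open>Where both leg products are defined, the sources on the left are the targets on
    the right, so the two conditions coincide.\<close>
  have "x * same_target y = same_source x * y" for x y :: "('a groupoid_algebra, 'a groupoid_algebra) tensor"
  proof (rule groupoid_tensor_ext[OF clinear_times_right clinear_compose[OF clinear_same_source clinear_times_right]])
    fix p q :: 'a assume pq: "p \<in> arrows" "q \<in> arrows"
    show "(gen p \<otimes> gen q) * same_target y = same_source (gen p \<otimes> gen q) * y"
      by (rule groupoid_tensor_ext[OF clinear_compose[OF clinear_same_target clinear_times_left] clinear_times_left])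
        (simp add: pq same_target_gen same_source_gen gen_times_gen)
  qed
  then show "groupoid_idempotent \<rhd> x = same_target x" "x \<lhd> groupoid_idempotent = same_source x"
    unfolding groupoid_idempotent_def by (rule centralizer[OF nondegenerate_groupoid2])+
qed

lemma groupoid_idempotent_gen:
  assumes "p \<in> arrows" "q \<in> arrows"
  shows "groupoid_idempotent \<rhd> (gen p \<otimes> gen q) = (if target p = target q then gen p \<otimes> gen q else 0)"
    and "(gen p \<otimes> gen q) \<lhd> groupoid_idempotent = (if source p = source q then gen p \<otimes> gen q else 0)"
  by (simp_all add: groupoid_idempotent same_target_gen same_source_gen assms)

section \<open>Generalized inverses of the canonical maps\<close>

definition groupoid_F where
  "groupoid_F = groupoid_lift2 (\<lambda>p q. if source p = target q then gen p \<otimes> gen q else 0)"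

lemma clinear_groupoid_F: "clinear groupoid_F"
  unfolding groupoid_F_def by (rule clinear_groupoid_lift2)

lemma groupoid_F_gen: "p \<in> arrows \<Longrightarrow> q \<in> arrows \<Longrightarrow>
    groupoid_F (gen p \<otimes> gen q) = (if source p = target q then gen p \<otimes> gen q else 0)"
  by (simp add: groupoid_F_def groupoid_lift2_gen)

definition groupoid_R1 where
  "groupoid_R1 = groupoid_lift2 (\<lambda>p q. if target p = target q then gen p \<otimes> gen (ginv p \<cdot> q) else 0)"

definition groupoid_R2 where
  "groupoid_R2 = groupoid_lift2 (\<lambda>p q. if source p = source q then gen (p \<cdot> ginv q) \<otimes> gen q else 0)"

lemma clinear_groupoid_R1: "clinear groupoid_R1"
  unfolding groupoid_R1_def by (rule clinear_groupoid_lift2)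

lemma clinear_groupoid_R2: "clinear groupoid_R2"
  unfolding groupoid_R2_def by (rule clinear_groupoid_lift2)

lemma groupoid_R1_gen: "p \<in> arrows \<Longrightarrow> q \<in> arrows \<Longrightarrow>
    groupoid_R1 (gen p \<otimes> gen q) = (if target p = target q then gen p \<otimes> gen (ginv p \<cdot> q) else 0)"
  by (simp add: groupoid_R1_def groupoid_lift2_gen)

lemma groupoid_R2_gen: "p \<in> arrows \<Longrightarrow> q \<in> arrows \<Longrightarrow>
    groupoid_R2 (gen p \<otimes> gen q) = (if source p = source q then gen (p \<cdot> ginv q) \<otimes> gen q else 0)"
  by (simp add: groupoid_R2_def groupoid_lift2_gen)

lemmas clinear_groupoid_maps = clinear_T1 clinear_T2 clinear_same_target clinear_same_source
  clinear_groupoid_F clinear_groupoid_R1 clinear_groupoid_R2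

lemmas groupoid_map_gen = T1_gen T2_gen gen_times_gen same_target_gen same_source_gen groupoid_F_gen
  groupoid_R1_gen groupoid_R2_gen groupoid_simps clinear_groupoid_maps[THEN clinear_zero]

text \<open>The identities T_1 R_1 = E, R_1 T_1 = F and E T_1 = T_1 determine range and kernel of
  T_1. The three that follow them do the same for T_2, with E acting from the right.\<close>

lemma T1_R1: "T1 groupoid_coproduct (groupoid_R1 x) = same_target x"
  by (rule groupoid_tensor_ext[OF clinear_compose[OF clinear_groupoid_R1 clinear_T1] clinear_same_target])
    (simp add: groupoid_map_gen)

lemma R1_T1: "groupoid_R1 (T1 groupoid_coproduct x) = groupoid_F x"
  by (rule groupoid_tensor_ext[OF clinear_compose[OF clinear_T1 clinear_groupoid_R1] clinear_groupoid_F])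
    (simp add: groupoid_map_gen)

lemma same_target_T1: "same_target (T1 groupoid_coproduct x) = T1 groupoid_coproduct x"
  by (rule groupoid_tensor_ext[OF clinear_compose[OF clinear_T1 clinear_same_target] clinear_T1])
    (simp add: groupoid_map_gen)

lemma T2_R2: "T2 groupoid_coproduct (groupoid_R2 x) = same_source x"
  by (rule groupoid_tensor_ext[OF clinear_compose[OF clinear_groupoid_R2 clinear_T2] clinear_same_source])
    (simp add: groupoid_map_gen)

lemma R2_T2: "groupoid_R2 (T2 groupoid_coproduct x) = groupoid_F x"
  by (rule groupoid_tensor_ext[OF clinear_compose[OF clinear_T2 clinear_groupoid_R2] clinear_groupoid_F])
    (simp add: groupoid_map_gen)

lemma same_source_T2: "same_source (T2 groupoid_coproduct x) = T2 groupoid_coproduct x"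
  by (rule groupoid_tensor_ext[OF clinear_compose[OF clinear_T2 clinear_same_source] clinear_T2])
    (simp add: groupoid_map_gen)
lemma canonical_groupoid_idempotent: "canonical_idempotent groupoid_coproduct groupoid_idempotent"
  unfolding canonical_idempotent_def
proof (intro conjI)
  show "groupoid_idempotent * groupoid_idempotent = (groupoid_idempotent ::
      ('a groupoid_algebra, 'a groupoid_algebra) tensor multiplier)"
  proof (rule multiplier_eqI_left[OF nondegenerate_groupoid2])
    show "(groupoid_idempotent * groupoid_idempotent) \<rhd> x = groupoid_idempotent \<rhd> x"
      for x :: "('a groupoid_algebra, 'a groupoid_algebra) tensor"
      by (rule groupoid_tensor_ext[OF clinear_mult_left clinear_mult_left])
        (simp add: groupoid_idempotent groupoid_map_gen)
  qed
  \<comment> \<open>One inclusion is T_1 x = E T_1 x, the other E x = T_1 R_1 x.\<close>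
  show "range (T1 groupoid_coproduct) = {groupoid_idempotent \<rhd> x | x. True}"
    by (auto simp: groupoid_idempotent) (metis same_target_T1, metis T1_R1 rangeI)
  show "range (T2 groupoid_coproduct) = {x \<lhd> groupoid_idempotent | x. True}"
    by (auto simp: groupoid_idempotent) (metis same_source_T2, metis T2_R2 rangeI)
qed

section \<open>Extension of the coproduct to multipliers\<close>

text \<open>Supplies the hypotheses of \<open>hom_extension_exists\<close>: a repeated leg passes
  the same membership test in U as the single one.\<close>

lemma diag_left_units:
  assumes "finite U" "U \<subseteq> target ` arrows"
  shows "diag_left w * (sum gen U \<otimes> sum gen U \<otimes> sum gen U) = diag_left (w * (sum gen U \<otimes> sum gen U))"
    and "(sum gen U \<otimes> sum gen U \<otimes> sum gen U) * diag_left w = diag_left ((sum gen U \<otimes> sum gen U) * w)"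
  by (rule groupoid_tensor_ext[OF clinear_times_right_comp[OF clinear_diag_left]
        clinear_compose[OF clinear_times_right clinear_diag_left]],
      simp add: assms diag_left_gen sum_units_gen clinear_zero[OF clinear_diag_left])
    (rule groupoid_tensor_ext[OF clinear_times_left_comp[OF clinear_diag_left]
        clinear_compose[OF clinear_times_left clinear_diag_left]],
      simp add: assms diag_left_gen sum_units_gen clinear_zero[OF clinear_diag_left])

lemma diag_right_units:
  assumes "finite U" "U \<subseteq> target ` arrows"
  shows "diag_right w * (sum gen U \<otimes> sum gen U \<otimes> sum gen U) = diag_right (w * (sum gen U \<otimes> sum gen U))"
    and "(sum gen U \<otimes> sum gen U \<otimes> sum gen U) * diag_right w = diag_right ((sum gen U \<otimes> sum gen U) * w)"
  by (rule groupoid_tensor_ext[OF clinear_times_right_comp[OF clinear_diag_right]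
        clinear_compose[OF clinear_times_right clinear_diag_right]],
      simp add: assms diag_right_gen sum_units_gen clinear_zero[OF clinear_diag_right])
    (rule groupoid_tensor_ext[OF clinear_times_left_comp[OF clinear_diag_right]
        clinear_compose[OF clinear_times_left clinear_diag_right]],
      simp add: assms diag_right_gen sum_units_gen clinear_zero[OF clinear_diag_right])

text \<open>Provides an explicit u at which the extension can be evaluated on basis elements. As the
  first two legs of \<open>diag_left w\<close> agree, both sides vanish unless p and q have the same
  target.\<close>

lemma diag_left_unit:
  assumes "p \<in> arrows" "q \<in> arrows" "r \<in> arrows"
  shows "diag_left w * (gen p \<otimes> gen q \<otimes> gen r) =
    diag_left (w * (gen (target p) \<otimes> gen (target r))) * (gen p \<otimes> gen q \<otimes> gen r)"
  by (rule groupoid_tensor_ext[OF clinear_times_right_comp[OF clinear_diag_left]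
        clinear_times_right_comp[OF clinear_compose[OF clinear_times_right clinear_diag_left]]])
    (simp add: assms diag_left_gen gen_times_gen groupoid_simps clinear_zero[OF clinear_diag_left])

lemma diag_right_unit:
  assumes "p \<in> arrows" "q \<in> arrows" "r \<in> arrows"
  shows "diag_right w * (gen p \<otimes> gen q \<otimes> gen r) =
    diag_right (w * (gen (target p) \<otimes> gen (target q))) * (gen p \<otimes> gen q \<otimes> gen r)"
  by (rule groupoid_tensor_ext[OF clinear_times_right_comp[OF clinear_diag_right]
        clinear_times_right_comp[OF clinear_compose[OF clinear_times_right clinear_diag_right]]])
    (simp add: assms diag_right_gen gen_times_gen groupoid_simps clinear_zero[OF clinear_diag_right])

lemma groupoid_multiplier3_eqI:
  fixes m n :: "('g::groupoid groupoid_algebra, ('g groupoid_algebra, 'g groupoid_algebra) tensor) tensor multiplier"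
  assumes "\<And>p q r. p \<in> arrows \<Longrightarrow> q \<in> arrows \<Longrightarrow> r \<in> arrows \<Longrightarrow>
    m \<rhd> (gen p \<otimes> gen q \<otimes> gen r) = n \<rhd> (gen p \<otimes> gen q \<otimes> gen r)"
  shows "m = n"
  by (rule multiplier_eqI_left[OF nondegenerate_groupoid3],
      rule groupoid_tensor3_ext[OF clinear_mult_left clinear_mult_left]) (rule assms)

text \<open>On a basis element, \<open>?E\<^sub>1\<close> tests equality of the first two targets
  and \<open>?E\<^sub>2\<close> of the last two. Both extensions of E test that all three
  agree.\<close>

lemma groupoid_idempotent_compatible:
  "idempotent_compatible (groupoid_coproduct :: 'g::groupoid groupoid_algebra coproduct_map) groupoid_idempotent"
proof -
  let ?E = "groupoid_idempotent :: ('g groupoid_algebra, 'g groupoid_algebra) tensor multiplier"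
  let ?E\<^sub>1 = "mult_assoc (?E \<otimes>\<^sub>M 1)" and ?E\<^sub>2 = "1 \<otimes>\<^sub>M ?E"
  note lu = local_unit_net_groupoid2 local_unit_net_groupoid3
  note E = groupoid_idempotent_gen clinear_zero[OF clinear_mult_left]
    clinear_zero[OF clinear_tensor_assoc] clinear_zero[OF clinear_tensor_assoc_inv]
  have ev_left: "\<forall>\<^sub>F U in unit_sets. \<forall>w. diag_left w * (sum gen U \<otimes> sum gen U \<otimes> sum gen U) =
        diag_left (w * (sum gen U \<otimes> sum gen U :: ('g groupoid_algebra, _) tensor))"
      "\<forall>\<^sub>F U in unit_sets. \<forall>w. (sum gen U \<otimes> sum gen U \<otimes> sum gen U) * diag_left w =
        diag_left ((sum gen U \<otimes> sum gen U :: ('g groupoid_algebra, _) tensor) * w)"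
    by (rule eventually_finite_subsets_at_top_weakI, rule allI, erule (1) diag_left_units)+
  have ev_right: "\<forall>\<^sub>F U in unit_sets. \<forall>w. diag_right w * (sum gen U \<otimes> sum gen U \<otimes> sum gen U) =
        diag_right (w * (sum gen U \<otimes> sum gen U :: ('g groupoid_algebra, _) tensor))"
      "\<forall>\<^sub>F U in unit_sets. \<forall>w. (sum gen U \<otimes> sum gen U \<otimes> sum gen U) * diag_right w =
        diag_right ((sum gen U \<otimes> sum gen U :: ('g groupoid_algebra, _) tensor) * w)"
    by (rule eventually_finite_subsets_at_top_weakI, rule allI, erule (1) diag_right_units)+
  obtain \<Phi> where \<Phi>: "algebra_hom \<Phi>" "\<forall>a :: ('g groupoid_algebra, _) tensor. \<Phi> (mult_of a) = mult_of (diag_left a)"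
    "\<forall>m y u. (\<forall>w. diag_left w * y = diag_left (w * u) * y) \<longrightarrow> \<Phi> m \<rhd> y = diag_left (m \<rhd> u) * y"
    using hom_extension_exists[OF lu algebra_hom_diag_left ev_left] by blast
  obtain \<Psi> where \<Psi>: "algebra_hom \<Psi>" "\<forall>a :: ('g groupoid_algebra, _) tensor. \<Psi> (mult_of a) = mult_of (diag_right a)"
    "\<forall>m y u. (\<forall>w. diag_right w * y = diag_right (w * u) * y) \<longrightarrow> \<Psi> m \<rhd> y = diag_right (m \<rhd> u) * y"
    using hom_extension_exists[OF lu algebra_hom_diag_right ev_right] by blast
  \<comment> \<open>Turns the defining property of each extension into a rewrite rule on basis
    elements.\<close>
  note \<Phi>_gen = \<Phi>(3)[rule_format, OF diag_left_unit] and \<Psi>_gen = \<Psi>(3)[rule_format, OF diag_right_unit]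
  note simps = E groupoid_simps gen_times_gen diag_left_gen diag_right_gen \<Phi>_gen \<Psi>_gen
    clinear_zero[OF clinear_diag_left] clinear_zero[OF clinear_diag_right]
  have "\<Phi> 1 = ?E\<^sub>1" "\<Psi> 1 = ?E\<^sub>2" "\<Psi> ?E = \<Phi> ?E" "\<Phi> ?E = ?E\<^sub>2 * ?E\<^sub>1" "?E\<^sub>2 * ?E\<^sub>1 = ?E\<^sub>1 * ?E\<^sub>2"
    by (rule groupoid_multiplier3_eqI, simp add: simps)+
  then show ?thesis
    unfolding idempotent_compatible_def hom_extension_def coproduct_left_eq coproduct_right_eq Let_def
    using \<Phi>(1,2) \<Psi>(1,2) by blast
qed

section \<open>The twisted multipliers\<close>

text \<open>Left multiplication preserves the source of the first leg and right multiplication the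
  target of the second, and \<open>groupoid_F\<close> compares just these.\<close>

lemma twisted_groupoid_F: "twisted_multiplier groupoid_F"
  unfolding twisted_multiplier_def
proof (intro conjI allI clinear_groupoid_F)
  let ?L = "\<lambda>a a' b b'. groupoid_F ((a' * a) \<otimes> (b * b'))"
  let ?R = "\<lambda>a a' b b'. ((mult_of a' \<otimes>\<^sub>M 1) \<rhd> groupoid_F (a \<otimes> b)) \<lhd> (1 \<otimes>\<^sub>M mult_of b')"
  fix a a' b b' :: "'a groupoid_algebra"
  note lin = clinear_rules clinear_compose[OF _ clinear_groupoid_F]
  have L: "clinear (\<lambda>a. ?L a a' b b')" "clinear (\<lambda>a'. ?L a a' b b')"
      "clinear (\<lambda>b. ?L a a' b b')" "clinear (\<lambda>b'. ?L a a' b b')"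
    and R: "clinear (\<lambda>a. ?R a a' b b')" "clinear (\<lambda>a'. ?R a a' b b')"
      "clinear (\<lambda>b. ?R a a' b b')" "clinear (\<lambda>b'. ?R a a' b b')" for a a' b b' :: "'a groupoid_algebra"
    by (intro lin)+
  have "?L (gen p) (gen p') (gen q) (gen q') = ?R (gen p) (gen p') (gen q) (gen q')"
    if "p \<in> arrows" "p' \<in> arrows" "q \<in> arrows" "q' \<in> arrows" for p p' q q' :: 'a
    using that by (simp add: groupoid_map_gen clinear_zero[OF clinear_mult_left] clinear_zero[OF clinear_mult_right])
  then have "?L (gen p) (gen p') (gen q) b' = ?R (gen p) (gen p') (gen q) b'"
    if "p \<in> arrows" "p' \<in> arrows" "q \<in> arrows" for p p' q :: 'a
    by (rule groupoid_ext[OF L(4) R(4)]) (use that in simp_all)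
  then have "?L (gen p) (gen p') b b' = ?R (gen p) (gen p') b b'"
    if "p \<in> arrows" "p' \<in> arrows" for p p' :: 'a
    by (rule groupoid_ext[OF L(3) R(3)]) (use that in simp_all)
  then have "?L (gen p) a' b b' = ?R (gen p) a' b b'" if "p \<in> arrows" for p :: 'a
    by (rule groupoid_ext[OF L(2) R(2)]) (use that in simp_all)
  then show "?L a a' b b' = ?R a a' b b'"
    by (rule groupoid_ext[OF L(1) R(1)])
qed

lemma tensor_lift_if:
  "cbilinear \<beta> \<Longrightarrow> tensor_lift \<beta> (if c then a \<otimes> b else 0) = (if c then \<beta> a b else 0)"
  by (simp add: tensor_lift_tensor clinear_zero[OF clinear_tensor_lift])

text \<open>On the basis E leaves p, r with equal sources. The left side requires s(p) = t(q) and
  s(r) = t(u), the right side t(q) = t(u) and s(r) = t(u), which is then the same.\<close>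

lemma F1_equation_groupoid: "F1_equation groupoid_idempotent groupoid_F"
  unfolding F1_equation_def
proof (intro allI)
  fix a b c d :: "'a groupoid_algebra"
  let ?\<beta> = "\<lambda>b d p q. groupoid_F (p \<otimes> b) \<otimes> (q * d)"
  let ?\<gamma> = "\<lambda>b d p q. p \<otimes> ((1 \<otimes>\<^sub>M mult_of q) \<rhd> groupoid_idempotent \<rhd> (b \<otimes> d))"
  let ?L = "\<lambda>b d x. tensor_assoc (tensor_lift (?\<beta> b d) (x \<lhd> groupoid_idempotent))"
  let ?R = "\<lambda>b d x. tensor_lift (?\<gamma> b d) (x \<lhd> groupoid_idempotent)"
  note lin = clinear_rules clinear_compose[OF _ clinear_groupoid_F]
  have \<beta>: "cbilinear (?\<beta> b d)" and \<gamma>: "cbilinear (?\<gamma> b d)" for b d :: "'a groupoid_algebra"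
    by (intro cbilinearI lin)+
  have L: "clinear (\<lambda>b. ?L b d x)" "clinear (\<lambda>d. ?L b d x)" "clinear (\<lambda>x. ?L b d x)"
    and R: "clinear (\<lambda>b. ?R b d x)" "clinear (\<lambda>d. ?R b d x)" "clinear (\<lambda>x. ?R b d x)" for b d :: "'a groupoid_algebra" and x
    by (intro clinear_tensor_assoc_comp clinear_tensor_lift_param \<beta> \<gamma> lin
        clinear_compose[OF clinear_mult_right clinear_tensor_lift[OF \<beta>]]
        clinear_compose[OF clinear_mult_right clinear_tensor_lift[OF \<gamma>]])+
  have "?L (gen q) (gen u) (gen p \<otimes> gen r) = ?R (gen q) (gen u) (gen p \<otimes> gen r)"
    if "p \<in> arrows" "q \<in> arrows" "r \<in> arrows" "u \<in> arrows" for p q r u :: 'a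
    using that unfolding groupoid_idempotent_gen(2)[OF that(1,3)] tensor_lift_if[OF \<beta>] tensor_lift_if[OF \<gamma>]
    by (simp add: groupoid_idempotent_gen groupoid_F_gen gen_times_gen clinear_zero[OF clinear_mult_left]
        clinear_zero[OF clinear_tensor_assoc])
  then have "?L (gen q) (gen u) x = ?R (gen q) (gen u) x" if "q \<in> arrows" "u \<in> arrows" for q u :: 'a and x
    by (rule groupoid_tensor_ext[OF L(3) R(3)]) (use that in simp_all)
  then have "?L (gen q) d x = ?R (gen q) d x" if "q \<in> arrows" for q :: 'a and x
    by (rule groupoid_ext[OF L(2) R(2)]) (use that in simp_all)
  then show "?L b d (a \<otimes> c) = ?R b d (a \<otimes> c)"
    by (rule groupoid_ext[OF L(1) R(1)])
qed

text \<open>Here E leaves p, r with equal targets; s(u) = t(p) and s(q) = t(r) on the left amount to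
  s(u) = s(q) and s(u) = t(p) on the right.\<close>

lemma F2_equation_groupoid: "F2_equation groupoid_idempotent groupoid_F"
  unfolding F2_equation_def
proof (intro allI)
  fix a b c d :: "'a groupoid_algebra"
  let ?\<beta> = "\<lambda>b d p q. (d * p) \<otimes> groupoid_F (b \<otimes> q)"
  let ?\<gamma> = "\<lambda>b d p q. ((d \<otimes> b) \<lhd> groupoid_idempotent \<lhd> (mult_of p \<otimes>\<^sub>M 1)) \<otimes> q"
  let ?L = "\<lambda>b d x. tensor_lift (?\<beta> b d) (groupoid_idempotent \<rhd> x)"
  let ?R = "\<lambda>b d x. tensor_assoc (tensor_lift (?\<gamma> b d) (groupoid_idempotent \<rhd> x))"
  note lin = clinear_rules clinear_compose[OF _ clinear_groupoid_F]
  have \<beta>: "cbilinear (?\<beta> b d)" and \<gamma>: "cbilinear (?\<gamma> b d)" for b d :: "'a groupoid_algebra"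
    by (intro cbilinearI lin)+
  have L: "clinear (\<lambda>b. ?L b d x)" "clinear (\<lambda>d. ?L b d x)" "clinear (\<lambda>x. ?L b d x)"
    and R: "clinear (\<lambda>b. ?R b d x)" "clinear (\<lambda>d. ?R b d x)" "clinear (\<lambda>x. ?R b d x)" for b d :: "'a groupoid_algebra" and x
    by (intro clinear_tensor_assoc_comp clinear_tensor_lift_param \<beta> \<gamma> lin
        clinear_compose[OF clinear_mult_left clinear_tensor_lift[OF \<beta>]]
        clinear_compose[OF clinear_mult_left clinear_tensor_lift[OF \<gamma>]])+
  have "?L (gen q) (gen u) (gen p \<otimes> gen r) = ?R (gen q) (gen u) (gen p \<otimes> gen r)"
    if "p \<in> arrows" "q \<in> arrows" "r \<in> arrows" "u \<in> arrows" for p q r u :: 'a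
    using that unfolding groupoid_idempotent_gen(1)[OF that(1,3)] tensor_lift_if[OF \<beta>] tensor_lift_if[OF \<gamma>]
    by (simp add: groupoid_idempotent_gen groupoid_F_gen gen_times_gen clinear_zero[OF clinear_mult_right]
        clinear_zero[OF clinear_tensor_assoc])
  then have "?L (gen q) (gen u) x = ?R (gen q) (gen u) x" if "q \<in> arrows" "u \<in> arrows" for q u :: 'a and x
    by (rule groupoid_tensor_ext[OF L(3) R(3)]) (use that in simp_all)
  then have "?L (gen q) d x = ?R (gen q) d x" if "q \<in> arrows" for q :: 'a and x
    by (rule groupoid_ext[OF L(2) R(2)]) (use that in simp_all)
  then show "?L b d (a \<otimes> c) = ?R b d (a \<otimes> c)"
    by (rule groupoid_ext[OF L(1) R(1)])
qed

section \<open>Uniqueness and the antipode\<close>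

text \<open>
  With \<open>c = \<lambda>\<^sub>p\<close> and \<open>d\<close> the source of \<open>p\<close> the third tensor factor of the equation for
  \<open>F\<^sub>1\<close> is \<open>\<lambda>\<^sub>p\<close> on both sides, and the counit removes it.
\<close>

lemma F1_unique:
  fixes F :: "('g::groupoid groupoid_algebra, 'g groupoid_algebra) tensor \<Rightarrow> _"
  assumes F: "clinear F" and eq: "F1_equation groupoid_idempotent F"
  shows "F = groupoid_F"
proof (rule ext, rule groupoid_tensor_ext[OF F clinear_groupoid_F])
  fix p q :: 'g assume pq: "p \<in> arrows" "q \<in> arrows"
  let ?u = "gen (source p)"
  have \<beta>: "cbilinear (\<lambda>p s. F (p \<otimes> b) \<otimes> (s * d))" for b d :: "'g groupoid_algebra"
    by (intro cbilinearI clinear_rules clinear_compose[OF _ F])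
  have \<gamma>: "cbilinear (\<lambda>p s. p \<otimes> ((1 \<otimes>\<^sub>M mult_of s) \<rhd> t))"
    for t :: "('g groupoid_algebra, 'g groupoid_algebra) tensor"
    by (intro cbilinearI clinear_rules)
  have "tensor_assoc (F (gen p \<otimes> gen q) \<otimes> gen p) = tensor_assoc (groupoid_F (gen p \<otimes> gen q) \<otimes> gen p)"
    using eq[unfolded F1_equation_def, THEN spec, of "gen p", THEN spec, of "gen q",
        THEN spec, of "gen p", THEN spec, of ?u] pq
    unfolding groupoid_idempotent_gen(2)[OF pq(1) pq(1)] tensor_lift_if[OF \<beta>] tensor_lift_if[OF \<gamma>]
    by (auto simp: groupoid_idempotent_gen groupoid_F_gen gen_times_gen groupoid_simps
        clinear_zero[OF clinear_mult_left] clinear_zero[OF clinear_tensor_assoc])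
  then have "F (gen p \<otimes> gen q) \<otimes> gen p = groupoid_F (gen p \<otimes> gen q) \<otimes> gen p"
    by (metis tensor_assoc_inv_assoc)
  then have "slice_right groupoid_counit (F (gen p \<otimes> gen q) \<otimes> gen p) =
      slice_right groupoid_counit (groupoid_F (gen p \<otimes> gen q) \<otimes> gen p)"
    by simp
  then show "F (gen p \<otimes> gen q) = groupoid_F (gen p \<otimes> gen q)"
    by (simp add: slice_right_tensor[OF clinear_groupoid_counit] groupoid_counit_gen pq)
qed

text \<open>Both composites with T = \<open>T1 \<Delta>\<close> are prescribed, so R = R T R = R T
  R' = R' T R' = R'.\<close>

lemma generalized_inverse_unique:
  assumes R: "generalized_inverse \<Delta> E F R" and R': "generalized_inverse \<Delta> E F R'"
    and T: "clinear (T1 \<Delta>)"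
  shows "R = R'"
proof
  fix x
  note lin = R[unfolded generalized_inverse_def, THEN conjunct1] R'[unfolded generalized_inverse_def, THEN conjunct1]
  have TR: "T1 \<Delta> (R x) = T1 \<Delta> (R' x)" for x
    by (rule tensor_ext[OF clinear_compose[OF lin(1) T] clinear_compose[OF lin(2) T]])
      (use R R' in \<open>simp add: generalized_inverse_def\<close>)
  have RT: "R (T1 \<Delta> x) = R' (T1 \<Delta> x)" for x
    by (rule tensor_ext[OF clinear_compose[OF T lin(1)] clinear_compose[OF T lin(2)]])
      (use R R' in \<open>simp add: generalized_inverse_def\<close>)
  have "R x = R (T1 \<Delta> (R x))" "R' x = R' (T1 \<Delta> (R' x))"
    using R R' by (simp_all add: generalized_inverse_def fun_eq_iff)
  then show "R x = R' x" by (simp add: TR RT)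
qed

lemma groupoid_structure:
  "weak_multiplier_Hopf_structure (groupoid_coproduct :: 'g::groupoid groupoid_algebra coproduct_map)
    groupoid_counit groupoid_idempotent groupoid_F groupoid_F"
  unfolding weak_multiplier_Hopf_structure_def
proof (intro conjI nondegenerate_groupoid idempotent_groupoid_algebra full_groupoid_coproduct
    groupoid_counit canonical_groupoid_idempotent groupoid_idempotent_compatible
    twisted_groupoid_F F1_equation_groupoid F2_equation_groupoid)
  let ?\<Delta> = "groupoid_coproduct :: 'g groupoid_algebra coproduct_map"
  \<comment> \<open>T_1 F = T_1 R_1 T_1 = E T_1 = T_1; conversely F = R_1 T_1 vanishes on the kernel
    of T_1.\<close>
  have "T1 ?\<Delta> (groupoid_F x) = T1 ?\<Delta> x" for x
    by (simp add: R1_T1[symmetric] T1_R1 same_target_T1)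
  then show "{x. T1 ?\<Delta> x = 0} = cspan {a \<otimes> b - groupoid_F (a \<otimes> b) | a b. True}"
    by (intro kernel_eq_span[OF clinear_T1 clinear_groupoid_F])
      (simp_all add: R1_T1[symmetric] clinear_zero[OF clinear_groupoid_R1])
  have "T2 ?\<Delta> (groupoid_F x) = T2 ?\<Delta> x" for x
    by (simp add: R2_T2[symmetric] T2_R2 same_source_T2)
  then show "{x. T2 ?\<Delta> x = 0} = cspan {a \<otimes> b - groupoid_F (a \<otimes> b) | a b. True}"
    by (intro kernel_eq_span[OF clinear_T2 clinear_groupoid_F])
      (simp_all add: R2_T2[symmetric] clinear_zero[OF clinear_groupoid_R2])
qed

lemma groupoid_generalized_inverse:
  "generalized_inverse (groupoid_coproduct :: 'g::groupoid groupoid_algebra coproduct_map)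
    groupoid_idempotent groupoid_F groupoid_R1"
proof -
  \<comment> \<open>The target of \<open>ginv p \<cdot> q\<close> is the source of p, so
    \<open>groupoid_F\<close> keeps every value of \<open>groupoid_R1\<close>.\<close>
  have "groupoid_F (groupoid_R1 x) = groupoid_R1 x" for x :: "('g groupoid_algebra, 'g groupoid_algebra) tensor"
    by (rule groupoid_tensor_ext[OF clinear_compose[OF clinear_groupoid_R1 clinear_groupoid_F] clinear_groupoid_R1])
      (simp add: groupoid_map_gen)
  then have "groupoid_R1 \<circ> T1 groupoid_coproduct \<circ> groupoid_R1 =
      (groupoid_R1 :: ('g groupoid_algebra, 'g groupoid_algebra) tensor \<Rightarrow> _)"
    by (simp add: fun_eq_iff R1_T1)
  moreover have "T1 groupoid_coproduct \<circ> groupoid_R1 \<circ> T1 groupoid_coproduct =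
      T1 (groupoid_coproduct :: 'g groupoid_algebra coproduct_map)"
    by (simp add: fun_eq_iff T1_R1 same_target_T1)
  ultimately show ?thesis
    by (simp add: generalized_inverse_def clinear_groupoid_R1 T1_R1 R1_T1 groupoid_idempotent)
qed

lemma antipode_groupoid:
  "antipode groupoid_coproduct = (\<lambda>a b. slice_left groupoid_counit (groupoid_R1 (a \<otimes> b)))"
  unfolding antipode_def
proof (rule the_equality)
  show "\<exists>\<epsilon> E F\<^sub>1 F\<^sub>2 R\<^sub>1. weak_multiplier_Hopf_structure groupoid_coproduct \<epsilon> E F\<^sub>1 F\<^sub>2 \<and>
      generalized_inverse groupoid_coproduct E F\<^sub>1 R\<^sub>1 \<and>
      (\<lambda>a b. slice_left groupoid_counit (groupoid_R1 (a \<otimes> b))) = (\<lambda>a b. slice_left \<epsilon> (R\<^sub>1 (a \<otimes> b)))"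
    using groupoid_structure groupoid_generalized_inverse by blast
  fix S :: "'a groupoid_algebra \<Rightarrow> 'a groupoid_algebra \<Rightarrow> 'a groupoid_algebra"
  assume "\<exists>\<epsilon> E F\<^sub>1 F\<^sub>2 R\<^sub>1. weak_multiplier_Hopf_structure groupoid_coproduct \<epsilon> E F\<^sub>1 F\<^sub>2 \<and>
      generalized_inverse groupoid_coproduct E F\<^sub>1 R\<^sub>1 \<and> S = (\<lambda>a b. slice_left \<epsilon> (R\<^sub>1 (a \<otimes> b)))"
  then obtain \<epsilon> E F\<^sub>1 F\<^sub>2 R\<^sub>1
    where W: "weak_multiplier_Hopf_structure (groupoid_coproduct :: 'a groupoid_algebra \<Rightarrow> _) \<epsilon> E F\<^sub>1 F\<^sub>2"
      and R: "generalized_inverse groupoid_coproduct E F\<^sub>1 R\<^sub>1"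
      and S: "S = (\<lambda>a b. slice_left \<epsilon> (R\<^sub>1 (a \<otimes> b)))"
    by blast
  have \<epsilon>: "counit groupoid_coproduct \<epsilon>" and E: "canonical_idempotent groupoid_coproduct E"
    and F: "twisted_multiplier F\<^sub>1" "F1_equation E F\<^sub>1"
    using W by (simp_all add: weak_multiplier_Hopf_structure_def)
  \<comment> \<open>The data of an arbitrary structure are identified in order: the counit and E
    first, then F_1 from E, then R_1 from both.\<close>
  have "\<epsilon> = groupoid_counit"
    by (rule ext, rule groupoid_ext[OF _ clinear_groupoid_counit])
      (use \<epsilon> in \<open>simp_all add: counit_iff groupoid_counit_gen\<close>)
  moreover have E': "E = groupoid_idempotent"
    by (rule canonical_idempotent_unique[OF nondegenerate_groupoid2 E canonical_groupoid_idempotent])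
  have F': "F\<^sub>1 = groupoid_F"
    using F E' by (intro F1_unique) (simp_all add: twisted_multiplier_def)
  have "R\<^sub>1 = groupoid_R1"
    by (rule generalized_inverse_unique[OF R[unfolded E' F'] groupoid_generalized_inverse clinear_T1])
  ultimately show "S = (\<lambda>a b. slice_left groupoid_counit (groupoid_R1 (a \<otimes> b)))"
    by (simp add: S)
qed

text \<open>For b = \<open>gen q\<close> with equal targets, the slice of R_1 is
  \<open>gen (ginv p \<cdot> q)\<close>. Otherwise R_1 gives 0, and so does the product, since the
  source of \<open>ginv p\<close> is the target of p.\<close>

lemma antipode_gen:
  assumes p: "p \<in> arrows"
  shows "antipode groupoid_coproduct (gen p) b = gen (ginv p) * b"
  unfolding antipode_groupoid
  by (rule groupoid_ext[OF clinear_compose[OF clinear_compose[OF clinear_tensor_right_comp[OF clinear_id]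
          clinear_groupoid_R1] clinear_slice_left[OF clinear_groupoid_counit]] clinear_times_left])
    (simp add: p groupoid_R1_gen slice_left_tensor[OF clinear_groupoid_counit] groupoid_counit_gen
      gen_times_gen groupoid_simps clinear_zero[OF clinear_slice_left[OF clinear_groupoid_counit]])

theorem proposition4p4:
  shows "weak_multiplier_Hopf_algebra
      (groupoid_coproduct :: 'g::groupoid groupoid_algebra \<Rightarrow>
        ('g groupoid_algebra, 'g groupoid_algebra) tensor multiplier) \<and>
    (\<forall>p\<in>(arrows :: 'g set). antipode groupoid_coproduct (gen p) = (\<lambda>b. gen (ginv p) * b))"
  using groupoid_structure antipode_gen unfolding weak_multiplier_Hopf_algebra_def by blast

end
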